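(* For each $N\ge2$, there exists a totally disconnected, perfect (closed, without isolated points) subset of $\mathbb{C}^N$ that intersects every analytic subvariety of $\mathbb{C}^N$ of positive dimension. *)

theory Defs
  imports "HOL-Analysis.Analysis"
begin

definition holomorphic_several :: "(complex^'n \<Rightarrow> complex) \<Rightarrow> (complex^'n) set \<Rightarrow> bool" where
  "holomorphic_several f U \<longleftrightarrow>
     (\<forall>x\<in>U. \<exists>f'. (f has_derivative f') (at x) \<and> (\<forall>c v. f' (c *s v) = c * f' v))"

definition analytic_subvariety :: "(complex^'n) set \<Rightarrow> bool" where
  "analytic_subvariety V \<longleftrightarrow> closed V \<and>
     (\<forall>p. \<exists>U F. open U \<and> p \<in> U \<and> finite F \<and>
        (\<forall>f\<in>F. holomorphic_several f U) \<and>
        V \<inter> U = {z\<in>U. \<forall>f\<in>F. f z = 0})"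

text \<open>An analytic set has dimension 0 at a point iff the point is isolated; hence
  V has positive dimension iff V has a non-isolated point.\<close>
definition positive_dimensional :: "(complex^'n) set \<Rightarrow> bool" where
  "positive_dimensional V \<longleftrightarrow> (\<exists>p\<in>V. p islimpt V)"

definition perfect_set :: "'a::topological_space set \<Rightarrow> bool" where
  "perfect_set S \<longleftrightarrow> closed S \<and> (\<forall>x\<in>S. x islimpt S)"

definition totally_disconnected :: "'a::topological_space set \<Rightarrow> bool" where
  "totally_disconnected S \<longleftrightarrow> (\<forall>C. C \<subseteq> S \<and> connected C \<longrightarrow> (\<exists>x. C \<subseteq> {x}))"

end

theory Submission
  imports Defs "HOL-Complex_Analysis.Complex_Analysis"
begin

text \<open>
  Let \<open>A\<close> be the set of condensation points of a positive-dimensional analytic set \<open>V\<close>.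
  Eliminating one variable at a time with resultants shows that a holomorphic function is open on \<open>V\<close>
  at every point that is isolated in its fibre; hence \<open>A\<close> is a nonempty closed set without peak points,
  and no function \<open>Re h + \<delta> \<bar>z\<bar>\<^sup>2\<close> with \<open>h\<close> holomorphic and \<open>\<delta> > 0\<close> has a local maximum on \<open>A\<close>.

  Now let \<open>Y\<close> be compact, \<open>j\<close> a coordinate, and cover the \<open>j\<close>-th coordinate plane by small discs
  with centres \<open>t\<close> and radius \<open>\<rho>\<close> such that no disc contains another centre. Give each centre its own small
  number \<open>r\<^sub>t > 0\<close>. If \<open>A\<close> contains a point \<open>y\<close> of \<open>Y\<close> with \<open>\<bar>y $ j - t\<bar> < \<rho>\<close>, then \<open>A\<close> meets
  \<open>{z. \<bar>z $ j - t\<bar> \<le> \<rho> \<and> dist z Y = r\<^sub>t} \<union> {z. z $ j = t \<and> dist z Y \<le> r\<^sub>t}\<close>: otherwise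
  \<open>- ln \<bar>z $ j - t\<bar> + \<delta> \<bar>z\<bar>\<^sup>2\<close> would have a local maximum on \<open>A\<close>. These compact sets are pairwise disjoint,
  arbitrarily close to \<open>Y\<close>, and thin in the direction \<open>j\<close>. Iterating over all coordinates and over
  decreasing thickness yields, near \<open>Y\<close>, a Cantor set that is hit by every such \<open>A\<close> that hits \<open>Y\<close>.
  Since \<open>A\<close> hits all large spheres, the union of such Cantor sets for the spheres of integral radius
  has the required property.
\<close>

no_notation fps_nth (infixl "$" 75)

subsection \<open>Integrals depending on a parameter\<close>

lemma continuous_on_compose_pair:
  assumes "continuous_on (A \<times> B) (\<lambda>(a,b). F a b)" "continuous_on C f" "continuous_on C g"
    and "\<And>x. x \<in> C \<Longrightarrow> f x \<in> A" "\<And>x. x \<in> C \<Longrightarrow> g x \<in> B"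
  shows "continuous_on C (\<lambda>x. F (f x) (g x))"
  using continuous_on_compose2[OF assms(1), of C "\<lambda>x. (f x, g x)"] assms(2-)
  by (auto intro: continuous_on_Pair)

lemma contour_integral_circlepath_cbox:
  "contour_integral (circlepath z r) f =
    integral (cbox 0 1) (\<lambda>x. f (circlepath z r x) * (2 * of_real pi * \<i> * of_real r * exp (2 * of_real pi * \<i> * of_real x)))"
  by (simp add: contour_integral_integral vector_derivative_circlepath)

lemma continuous_on_circlepath: "continuous_on A (circlepath z r)"
  unfolding circlepath by (intro continuous_intros)

text \<open>Cauchy's formula over one fixed circle, parametrised by the unit interval so that
  theorems on integrals with parameters apply. The point \<open>v\<close> may move inside the disc
  while the path stays put.\<close>

lemma deriv_eq_integral_circle:
  assumes "open S" "f holomorphic_on S" "cball w r \<subseteq> S" "v \<in> ball w r"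
  shows "deriv f v = 1 / (2 * of_real pi * \<i>) * integral (cbox 0 1)
    (\<lambda>x. f (circlepath w r x) / (circlepath w r x - v)\<^sup>2 *
         (2 * of_real pi * \<i> * of_real r * exp (2 * of_real pi * \<i> * of_real x)))"
proof -
  have "continuous_on (cball w r) f"
    by (meson assms holomorphic_on_imp_continuous_on holomorphic_on_subset)
  moreover have "f holomorphic_on ball w r"
    by (meson assms ball_subset_cball holomorphic_on_subset order_trans)
  ultimately show ?thesis
    using Cauchy_derivative_integral_circlepath(2)[of w r f v] assms
    by (simp add: contour_integral_circlepath_cbox DERIV_imp_deriv)
qed

lemma circlepath_neq_ball:
  assumes "v \<in> ball w r"
  shows "circlepath w r x \<noteq> v"
proof
  assume "circlepath w r x = v"
  then have "dist w v = \<bar>r\<bar>"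
    by (auto simp: circlepath dist_norm norm_mult)
  with assms show False by (auto simp: dist_norm)
qed

lemma circlepath_in_cball: "r \<ge> 0 \<Longrightarrow> circlepath w r x \<in> cball w r"
  by (auto simp: circlepath dist_norm norm_mult)

text \<open>Locally the derivative is a Cauchy integral over a fixed circle, and the kernel of that
  integral is jointly continuous in the parameter and the point.\<close>

lemma continuous_on_deriv_parameter:
  fixes F :: "'a::t2_space \<Rightarrow> complex \<Rightarrow> complex"
  assumes cont: "continuous_on (T \<times> S) (\<lambda>(t,w). F t w)" and "open S"
    and hol: "\<And>t. t \<in> T \<Longrightarrow> F t holomorphic_on S"
  shows "continuous_on (T \<times> S) (\<lambda>(t,w). deriv (F t) w)"
proof -
  have "continuous (at (t,w) within T \<times> S) (\<lambda>(t,w). deriv (F t) w)" if "t \<in> T" "w \<in> S" for t w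
  proof -
    obtain r where r: "r > 0" "cball w r \<subseteq> S"
      using \<open>open S\<close> \<open>w \<in> S\<close> open_contains_cball by blast
    define K where "K = (\<lambda>p x. F (fst p) (circlepath w r x) / (circlepath w r x - snd p)\<^sup>2 *
         (2 * of_real pi * \<i> * of_real r * exp (2 * of_real pi * \<i> * of_real x)))"
    have c1: "continuous_on ((T \<times> ball w r) \<times> cbox 0 (1::real)) (\<lambda>q. F (fst (fst q)) (circlepath w r (snd q)))"
      by (intro continuous_on_compose_pair[OF cont] continuous_on_compose2[OF continuous_on_circlepath[of UNIV]] continuous_intros)
         (use r circlepath_in_cball[of r w] in \<open>auto simp: subset_iff\<close>)
    have "continuous_on ((T \<times> ball w r) \<times> cbox 0 (1::real)) (\<lambda>(p,x). K p x)"
      unfolding K_def case_prod_beta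
      by (intro continuous_intros c1 continuous_on_compose2[OF continuous_on_circlepath[of UNIV]])
         (use circlepath_neq_ball in fastforce)+
    then have "continuous_on (T \<times> ball w r) (\<lambda>p. 1 / (2 * of_real pi * \<i>) * integral (cbox 0 1) (K p))"
      by (intro continuous_intros integral_continuous_on_param)
    moreover have "(\<lambda>(t,w). deriv (F t) w) p = 1 / (2 * of_real pi * \<i>) * integral (cbox 0 1) (K p)"
      if "p \<in> T \<times> ball w r" for p
      using that deriv_eq_integral_circle[OF \<open>open S\<close> hol r(2), of "fst p" "snd p"]
      by (auto simp: K_def)
    ultimately have "continuous_on (T \<times> ball w r) (\<lambda>(t,w). deriv (F t) w)"
      by (simp cong: continuous_on_cong)
    then have "continuous (at (t,w) within T \<times> ball w r) (\<lambda>(t,w). deriv (F t) w)"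
      using that r by (simp add: continuous_on_eq_continuous_within)
    moreover have "at (t,w) within T \<times> ball w r = at (t,w) within T \<times> S"
      by (rule at_within_nhd[of _ "UNIV \<times> ball w r"]) (use r in \<open>auto intro: open_Times\<close>)
    ultimately show ?thesis by simp
  qed
  then show ?thesis
    by (auto simp: continuous_on_eq_continuous_within)
qed

text \<open>Differentiation under the integral sign; the joint continuity of the derivative comes
  from \<open>continuous_on_deriv_parameter\<close>, with the integration variable as
  parameter.\<close>

lemma holomorphic_on_integral_parameter:
  fixes K :: "complex \<Rightarrow> real \<Rightarrow> complex"
  assumes cont: "continuous_on (Y \<times> cbox 0 1) (\<lambda>(y,t). K y t)" and "open Y" "convex Y"
    and hol: "\<And>t. t \<in> cbox 0 1 \<Longrightarrow> (\<lambda>y. K y t) holomorphic_on Y"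
  shows "(\<lambda>y. integral (cbox 0 1) (K y)) holomorphic_on Y"
proof (rule leibniz_rule_holomorphic[where fx = "\<lambda>y t. deriv (\<lambda>y. K y t) y"])
  show "((\<lambda>y. K y t) has_field_derivative deriv (\<lambda>y. K y t) y) (at y within Y)"
    if "y \<in> Y" "t \<in> cbox 0 1" for y t
    using hol[OF that(2)] that(1) \<open>open Y\<close>
    by (metis has_field_derivative_at_within holomorphic_derivI)
  show "K y integrable_on cbox 0 1" if "y \<in> Y" for y
  proof -
    have "continuous_on (cbox 0 1) (\<lambda>t. K y t)"
      by (rule continuous_on_compose_pair[OF cont]) (use that in \<open>auto intro!: continuous_intros\<close>)
    then show ?thesis
      by (intro integrable_continuous)
  qed
  have "continuous_on (cbox 0 1 \<times> Y) (\<lambda>(t,y). K y t)"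
    unfolding case_prod_beta by (rule continuous_on_compose_pair[OF cont]) (auto intro!: continuous_intros)
  from continuous_on_deriv_parameter[OF this \<open>open Y\<close> hol]
  have "continuous_on (cbox 0 1 \<times> Y) (\<lambda>(t,y). deriv (\<lambda>y. K y t) y)" by simp
  then show "continuous_on (Y \<times> cbox 0 1) (\<lambda>(y,t). deriv (\<lambda>y. K y t) y)"
    unfolding case_prod_beta[where p = "_ :: complex \<times> real"]
    by (rule continuous_on_compose_pair) (auto intro!: continuous_intros)
qed fact

text \<open>Cauchy's formula turns the derivative in \<open>w\<close> into an integral over a circle
  whose integrand is holomorphic in \<open>y\<close>.\<close>

lemma holomorphic_on_deriv_parameter:
  fixes \<Phi> :: "complex \<Rightarrow> complex \<Rightarrow> complex"
  assumes cont: "continuous_on (Y \<times> S) (\<lambda>(y,w). \<Phi> y w)" and "open Y" "convex Y" "open S" "w \<in> S"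
    and hol1: "\<And>y. y \<in> Y \<Longrightarrow> \<Phi> y holomorphic_on S"
    and hol2: "\<And>w. w \<in> S \<Longrightarrow> (\<lambda>y. \<Phi> y w) holomorphic_on Y"
  shows "(\<lambda>y. deriv (\<Phi> y) w) holomorphic_on Y"
proof -
  obtain r where r: "r > 0" "cball w r \<subseteq> S"
    using \<open>open S\<close> \<open>w \<in> S\<close> open_contains_cball by blast
  have in_S: "circlepath w r x \<in> S" for x
    using circlepath_in_cball[of r w x] r by auto
  have ne: "circlepath w r x \<noteq> w" for x
    using circlepath_neq_ball[of w w r x] r by simp
  have c1: "continuous_on (Y \<times> cbox 0 (1::real)) (\<lambda>q. \<Phi> (fst q) (circlepath w r (snd q)))"
    by (intro continuous_on_compose_pair[OF cont] continuous_on_compose2[OF continuous_on_circlepath[of UNIV]] continuous_intros)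
       (use in_S in auto)
  have "(\<lambda>y. integral (cbox 0 1) (\<lambda>x. \<Phi> y (circlepath w r x) / (circlepath w r x - w)\<^sup>2 *
         (2 * of_real pi * \<i> * of_real r * exp (2 * of_real pi * \<i> * of_real x)))) holomorphic_on Y"
  proof (rule holomorphic_on_integral_parameter)
    show "continuous_on (Y \<times> cbox 0 1) (\<lambda>(y, x). \<Phi> y (circlepath w r x) / (circlepath w r x - w)\<^sup>2 *
         (2 * of_real pi * \<i> * of_real r * exp (2 * of_real pi * \<i> * of_real x)))"
      unfolding case_prod_beta
      by (intro continuous_intros c1 continuous_on_compose2[OF continuous_on_circlepath[of UNIV]])
         (use ne in auto)
  qed (use \<open>open Y\<close> \<open>convex Y\<close> ne in_S in \<open>auto intro!: holomorphic_intros hol2\<close>)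
  then have "(\<lambda>y. 1 / (2 * of_real pi * \<i>) * integral (cbox 0 1) (\<lambda>x. \<Phi> y (circlepath w r x) / (circlepath w r x - w)\<^sup>2 *
         (2 * of_real pi * \<i> * of_real r * exp (2 * of_real pi * \<i> * of_real x)))) holomorphic_on Y"
    by (intro holomorphic_intros)
  then show ?thesis
    by (rule holomorphic_transform)
       (use deriv_eq_integral_circle[OF \<open>open S\<close> hol1 r(2)] r in auto)
qed

subsection \<open>Products over the roots of a holomorphic function\<close>

text \<open>The analogue of the resultant of a Weierstrass polynomial with \<psi>, formed directly
  from the zeros of \<phi> in the disc. It stays holomorphic in parameters although the single roots
  need not.\<close>

definition root_product :: "real \<Rightarrow> (complex \<Rightarrow> complex) \<Rightarrow> (complex \<Rightarrow> complex) \<Rightarrow> complex" where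
  "root_product \<rho> \<phi> \<psi> = (\<Prod>\<alpha> | \<alpha> \<in> ball 0 \<rho> \<and> \<phi> \<alpha> = 0. \<psi> \<alpha> ^ nat (zorder \<phi> \<alpha>))"

section \<open>Counting and weighting roots by contour integrals\<close>

lemma finite_roots:
  assumes "0 < \<rho>" "\<rho> < \<rho>'" "\<phi> holomorphic_on ball 0 \<rho>'" "\<And>w. cmod w = \<rho> \<Longrightarrow> \<phi> w \<noteq> 0" "r < \<rho>'"
  shows "finite {\<alpha> \<in> cball 0 r. \<phi> \<alpha> = 0}"
proof (cases "\<phi> constant_on ball 0 \<rho>'")
  case True
  then obtain c where c: "\<And>w. w \<in> ball 0 \<rho>' \<Longrightarrow> \<phi> w = c" by (auto simp: constant_on_def)
  have "c \<noteq> 0"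
    using assms(4)[of "of_real \<rho>"] c[of "of_real \<rho>"] assms(1,2) by auto
  then have "{\<alpha> \<in> cball 0 r. \<phi> \<alpha> = 0} = {}"
    using c assms by (auto simp: subset_iff)
  then show ?thesis by (simp only: finite.emptyI)
next
  case False
  moreover have "cball 0 r \<subseteq> ball (0::complex) \<rho>'" using assms(5) by (simp add: subset_iff)
  ultimately show ?thesis
    using holomorphic_compact_finite_zeros[OF assms(3) _ _ _ _ False, of "cball 0 r"] by simp
qed

lemma zorder_root_pos:
  assumes "0 < \<rho>" "\<rho> < \<rho>'" "\<phi> holomorphic_on ball 0 \<rho>'" "\<And>w. cmod w = \<rho> \<Longrightarrow> \<phi> w \<noteq> 0"
    and "\<alpha> \<in> ball 0 \<rho>'" "\<phi> \<alpha> = 0"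
  shows "zorder \<phi> \<alpha> > 0"
proof -
  have "\<exists>w\<in>ball 0 \<rho>'. \<phi> w \<noteq> 0"
    using assms(1,2) assms(4)[of "of_real \<rho>"] by (intro bexI[of _ "of_real \<rho>"]) auto
  from zorder_exist_zero[OF assms(3) _ _ assms(5) this] show ?thesis
    using assms(6) by simp
qed

text \<open>The argument principle weighted by \<kappa>: roots inside the circle have winding number
  1, those outside have 0.\<close>

lemma contour_integral_log_derivative:
  assumes \<rho>: "0 < \<rho>" "\<rho> < \<rho>'" and \<phi>: "\<phi> holomorphic_on ball 0 \<rho>'" and nz: "\<And>w. cmod w = \<rho> \<Longrightarrow> \<phi> w \<noteq> 0"
    and \<kappa>: "\<kappa> holomorphic_on ball 0 \<rho>'"
  shows "contour_integral (circlepath 0 \<rho>) (\<lambda>x. deriv \<phi> x * \<kappa> x / \<phi> x) =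
     2 * pi * \<i> * (\<Sum>\<alpha> | \<alpha> \<in> ball 0 \<rho> \<and> \<phi> \<alpha> = 0. \<kappa> \<alpha> * of_nat (nat (zorder \<phi> \<alpha>)))"
proof -
  \<comment> \<open>An intermediate radius: the argument principle needs finitely many zeros in its
    domain, and \<open>ball 0 s\<close> has them because its closure lies in
    \<open>ball 0 \<rho>'\<close>.\<close>
  define s where "s = (\<rho> + \<rho>') / 2"
  have s: "\<rho> < s" "s < \<rho>'" using \<rho> by (auto simp: s_def)
  have sub: "ball 0 s \<subseteq> ball (0::complex) \<rho>'" using s by auto
  define Z where "Z = {w \<in> ball 0 s. \<phi> w = 0 \<or> w \<in> {}}"
  have finZ: "finite Z"
    using finite_roots[OF \<rho> \<phi> nz s(2)] by (rule finite_subset[rotated]) (auto simp: Z_def)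
  have "contour_integral (circlepath 0 \<rho>) (\<lambda>x. deriv \<phi> x * \<kappa> x / \<phi> x) =
    2 * pi * \<i> * (\<Sum>p\<in>Z. winding_number (circlepath 0 \<rho>) p * \<kappa> p * zorder \<phi> p)"
    unfolding Z_def
  proof (rule argument_principle)
    show "\<phi> holomorphic_on ball 0 s - {}" "\<kappa> holomorphic_on ball 0 s"
      using holomorphic_on_subset[OF \<phi> sub] holomorphic_on_subset[OF \<kappa> sub] by auto
    show "path_image (circlepath 0 \<rho>) \<subseteq> ball 0 s - {w \<in> ball 0 s. \<phi> w = 0 \<or> w \<in> {}}"
      using nz s \<rho> by (auto simp: path_image_circlepath)
    show "\<forall>z. z \<notin> ball 0 s \<longrightarrow> winding_number (circlepath 0 \<rho>) z = 0"
    proof (intro allI impI)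
      fix z :: complex assume "z \<notin> ball 0 s"
      then show "winding_number (circlepath 0 \<rho>) z = 0"
        using \<rho> s by (intro winding_number_zero_outside[of _ "cball 0 \<rho>"])
          (auto simp: path_image_circlepath)
    qed
    show "finite {w \<in> ball 0 s. \<phi> w = 0 \<or> w \<in> {}}" using finZ by (simp add: Z_def)
  qed auto
  also have "(\<Sum>p\<in>Z. winding_number (circlepath 0 \<rho>) p * \<kappa> p * zorder \<phi> p) =
      (\<Sum>\<alpha> | \<alpha> \<in> ball 0 \<rho> \<and> \<phi> \<alpha> = 0. \<kappa> \<alpha> * of_nat (nat (zorder \<phi> \<alpha>)))"
  proof (rule sum.mono_neutral_cong_right[OF finZ])
    show "{\<alpha>. \<alpha> \<in> ball 0 \<rho> \<and> \<phi> \<alpha> = 0} \<subseteq> Z" using s by (auto simp: Z_def)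
    show "\<forall>p\<in>Z - {\<alpha>. \<alpha> \<in> ball 0 \<rho> \<and> \<phi> \<alpha> = 0}. winding_number (circlepath 0 \<rho>) p * \<kappa> p * zorder \<phi> p = 0"
    proof
      fix p assume p: "p \<in> Z - {\<alpha>. \<alpha> \<in> ball 0 \<rho> \<and> \<phi> \<alpha> = 0}"
      then have "cmod p > \<rho>" using nz[of p] by (force simp: Z_def)
      then have "winding_number (circlepath 0 \<rho>) p = 0"
        using \<rho> by (intro winding_number_zero_outside[of _ "cball 0 \<rho>"])
          (auto simp: path_image_circlepath)
      then show "winding_number (circlepath 0 \<rho>) p * \<kappa> p * zorder \<phi> p = 0" by simp
    qed
    fix p assume "p \<in> {\<alpha>. \<alpha> \<in> ball 0 \<rho> \<and> \<phi> \<alpha> = 0}"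
    then have p: "p \<in> ball 0 \<rho>" "p \<in> ball 0 \<rho>'" "\<phi> p = 0" using \<rho> by auto
    have "winding_number (circlepath 0 \<rho>) p = 1"
      using p by (intro winding_number_circlepath) auto
    moreover have "zorder \<phi> p > 0" by (rule zorder_root_pos[OF \<rho> \<phi> nz]) (use p in auto)
    ultimately show "winding_number (circlepath 0 \<rho>) p * \<kappa> p * zorder \<phi> p = \<kappa> p * of_nat (nat (zorder \<phi> p))"
      by simp
  qed
  finally show ?thesis .
qed

lemma root_product_eq_0_iff:
  assumes \<rho>: "0 < \<rho>" "\<rho> < \<rho>'" and \<phi>: "\<phi> holomorphic_on ball 0 \<rho>'" and nz: "\<And>w. cmod w = \<rho> \<Longrightarrow> \<phi> w \<noteq> 0"
  shows "root_product \<rho> \<phi> \<psi> = 0 \<longleftrightarrow> (\<exists>\<alpha>\<in>ball 0 \<rho>. \<phi> \<alpha> = 0 \<and> \<psi> \<alpha> = 0)"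
proof -
  have "finite {\<alpha>. \<alpha> \<in> ball 0 \<rho> \<and> \<phi> \<alpha> = 0}"
    using finite_roots[OF \<rho> \<phi> nz \<rho>(2)] by (rule finite_subset[rotated]) auto
  moreover have "zorder \<phi> \<alpha> > 0" if "\<alpha> \<in> ball 0 \<rho>" "\<phi> \<alpha> = 0" for \<alpha>
    by (rule zorder_root_pos[OF \<rho> \<phi> nz]) (use that \<rho> in auto)
  ultimately show ?thesis
    unfolding root_product_def by auto
qed

text \<open>Each monomial of degree between 1 and \<open>n - 1\<close> sums to zero over the
  \<open>n\<close>-th roots of unity, by the geometric sum, so only the constant term
  survives.\<close>

lemma sum_poly_roots_of_unity:
  fixes p :: "complex poly"
  assumes "degree p < n"
  shows "(\<Sum>k<n. poly p (M * cis (2 * pi * real k / real n))) = of_nat n * poly p 0"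
proof -
  have n: "n > 0" using assms by simp
  have *: "(\<Sum>k<n. (M * cis (2 * pi * real k / real n)) ^ j) = (if j = 0 then of_nat n else 0)" if "j < n" for j
  proof (cases "j = 0")
    case False
    define z where "z = cis (2 * pi * real j / real n)"
    have zk: "cis (2 * pi * real k / real n) ^ j = z ^ k" for k
      unfolding z_def Complex.DeMoivre by (rule arg_cong[of _ _ cis]) simp
    have "z ^ n = 1"
      unfolding z_def Complex.DeMoivre using n cis_multiple_2pi[of "real j"] by simp
    moreover have "z \<noteq> 1"
    proof
      assume "z = 1"
      then have "cis (2 * pi * real j / real n) = cis (2 * pi * real 0 / real n)" by (simp add: z_def)
      moreover have "inj_on (\<lambda>k. cis (2 * pi * real k / real n)) {..<n}"
        using Complex.bij_betw_roots_unity[OF n] by (simp add: bij_betw_def)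
      ultimately have "j = 0" using that n by (rule_tac inj_onD[of "\<lambda>k. cis (2 * pi * real k / real n)" "{..<n}"]) auto
      with False show False by simp
    qed
    ultimately have "(\<Sum>k<n. z ^ k) = 0" by (simp add: geometric_sum)
    then show ?thesis
      using False by (simp add: power_mult_distrib zk flip: sum_distrib_left)
  qed simp
  have "(\<Sum>k<n. poly p (M * cis (2 * pi * real k / real n))) =
      (\<Sum>k<n. \<Sum>j\<le>degree p. coeff p j * (M * cis (2 * pi * real k / real n)) ^ j)"
    by (simp add: poly_altdef)
  also have "\<dots> = (\<Sum>j\<le>degree p. coeff p j * (\<Sum>k<n. (M * cis (2 * pi * real k / real n)) ^ j))"
    by (subst sum.swap) (simp add: sum_distrib_left)
  also have "\<dots> = (\<Sum>j\<le>degree p. coeff p j * (if j = 0 then of_nat n else 0))"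
    using assms by (intro sum.cong refl) (simp add: *)
  also have "\<dots> = of_nat n * poly p 0"
    by (simp add: if_distrib sum.delta poly_0_coeff_0 cong: if_cong)
  finally show ?thesis .
qed

text \<open>By the argument principle this is the sum of \<kappa> over the roots inside the circle,
  with multiplicity. In integral form its dependence on parameters can be controlled without
  following single roots.\<close>

definition log_integral :: "real \<Rightarrow> (complex \<Rightarrow> complex) \<Rightarrow> (complex \<Rightarrow> complex) \<Rightarrow> complex" where
  "log_integral \<rho> \<phi> \<kappa> = 1 / (2 * pi * \<i>) * contour_integral (circlepath 0 \<rho>) (\<lambda>x. deriv \<phi> x * \<kappa> x / \<phi> x)"

text \<open>The product of \<open>\<tau> - \<psi>\<close> over the roots is a polynomial in \<open>\<tau>\<close> which, for large \<open>\<tau>\<close>, is the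
  exponential of a contour integral; averaging over roots of unity recovers its value at \<open>\<tau> = 0\<close>.\<close>

lemma root_product_eq:
  assumes \<rho>: "0 < \<rho>" "\<rho> < \<rho>'" and \<phi>: "\<phi> holomorphic_on ball 0 \<rho>'" and nz: "\<And>w. cmod w = \<rho> \<Longrightarrow> \<phi> w \<noteq> 0"
    and \<psi>: "\<psi> holomorphic_on ball 0 \<rho>'" and bound: "\<And>w. w \<in> ball 0 \<rho>' \<Longrightarrow> cmod (\<psi> w) < M"
    and d: "of_nat d = log_integral \<rho> \<phi> (\<lambda>_. 1)"
  shows "root_product \<rho> \<phi> \<psi> = (-1) ^ d / of_nat (Suc d) * (\<Sum>k<Suc d.
      (of_real M * cis (2 * pi * real k / real (Suc d))) ^ d *
      exp (log_integral \<rho> \<phi> (\<lambda>w. Ln (1 - \<psi> w / (of_real M * cis (2 * pi * real k / real (Suc d)))))))"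
proof -
  define Z where "Z = {\<alpha>. \<alpha> \<in> ball 0 \<rho> \<and> \<phi> \<alpha> = 0}"
  define m where "m = (\<lambda>\<alpha>. nat (zorder \<phi> \<alpha>))"
  \<comment> \<open>The monic polynomial with roots \<open>\<psi> \<alpha>\<close>; its constant
    term is the wanted product up to sign.\<close>
  define p where "p = (\<Prod>\<alpha>\<in>Z. [:- \<psi> \<alpha>, 1:] ^ m \<alpha>)"
  have finZ: "finite Z"
    using finite_roots[OF \<rho> \<phi> nz \<rho>(2)] unfolding Z_def by (rule finite_subset[rotated]) auto
  have "M > 0" using bound[of 0] \<rho> norm_ge_zero[of "\<psi> 0"] by (simp del: norm_ge_zero)
  have li: "log_integral \<rho> \<phi> \<kappa> = (\<Sum>\<alpha>\<in>Z. \<kappa> \<alpha> * of_nat (m \<alpha>))" if "\<kappa> holomorphic_on ball 0 \<rho>'" for \<kappa>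
    using contour_integral_log_derivative[OF \<rho> \<phi> nz that] by (simp add: log_integral_def Z_def m_def)
  have "complex_of_nat d = of_nat (\<Sum>\<alpha>\<in>Z. m \<alpha>)"
    using d li[of "\<lambda>_. 1"] by simp
  then have d: "d = (\<Sum>\<alpha>\<in>Z. m \<alpha>)" by (simp only: of_nat_eq_iff)
  have "degree p = d"
    unfolding p_def d by (subst degree_prod_eq_sum_degree) (auto simp: degree_linear_power)
  \<comment> \<open>Since \<open>cmod (\<psi> w) < M = cmod \<tau>\<close>, the values
    \<open>1 - \<psi> w / \<tau>\<close> have positive real part. Thus the principal
    \<open>Ln\<close> is holomorphic there and turns the product over the roots into a sum.\<close>
  have exp_eq: "poly p \<tau> = \<tau> ^ d * exp (log_integral \<rho> \<phi> (\<lambda>w. Ln (1 - \<psi> w / \<tau>)))" if \<tau>: "cmod \<tau> = M" for \<tau>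
  proof -
    have "\<tau> \<noteq> 0" using \<tau> \<open>M > 0\<close> by auto
    have re: "Re (1 - \<psi> w / \<tau>) > 0" if "w \<in> ball 0 \<rho>'" for w
    proof -
      have "cmod (\<psi> w / \<tau>) < 1" using bound[OF that] \<tau> \<open>M > 0\<close> by (simp add: norm_divide)
      then show ?thesis using complex_Re_le_cmod[of "\<psi> w / \<tau>"] by simp
    qed
    have "(\<lambda>w. Ln (1 - \<psi> w / \<tau>)) holomorphic_on ball 0 \<rho>'"
      using re \<open>\<tau> \<noteq> 0\<close> by (intro holomorphic_intros \<psi>) (force simp: complex_nonpos_Reals_iff)+
    then have "exp (log_integral \<rho> \<phi> (\<lambda>w. Ln (1 - \<psi> w / \<tau>))) = (\<Prod>\<alpha>\<in>Z. exp (Ln (1 - \<psi> \<alpha> / \<tau>) * of_nat (m \<alpha>)))"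
      by (simp add: li exp_sum finZ)
    also have "\<dots> = (\<Prod>\<alpha>\<in>Z. (1 - \<psi> \<alpha> / \<tau>) ^ m \<alpha>)"
    proof (intro prod.cong refl)
      fix \<alpha> assume "\<alpha> \<in> Z"
      then have "1 - \<psi> \<alpha> / \<tau> \<noteq> 0" using re[of \<alpha>] \<rho> by (force simp: Z_def)
      then show "exp (Ln (1 - \<psi> \<alpha> / \<tau>) * of_nat (m \<alpha>)) = (1 - \<psi> \<alpha> / \<tau>) ^ m \<alpha>"
        by (simp add: exp_of_nat2_mult)
    qed
    also have "\<tau> ^ d * \<dots> = (\<Prod>\<alpha>\<in>Z. (\<tau> * (1 - \<psi> \<alpha> / \<tau>)) ^ m \<alpha>)"
      by (simp add: d power_sum power_mult_distrib prod.distrib)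
    also have "\<dots> = poly p \<tau>"
      using \<open>\<tau> \<noteq> 0\<close> by (simp add: p_def poly_prod algebra_simps)
    finally show ?thesis ..
  qed
  have "root_product \<rho> \<phi> \<psi> = (-1) ^ d * poly p 0"
  proof -
    have "(-1) ^ d * poly p 0 = (\<Prod>\<alpha>\<in>Z. (-1) ^ m \<alpha> * (- \<psi> \<alpha>) ^ m \<alpha>)"
      by (simp add: p_def poly_prod d power_sum prod.distrib)
    also have "\<dots> = (\<Prod>\<alpha>\<in>Z. \<psi> \<alpha> ^ m \<alpha>)"
      by (simp flip: power_mult_distrib)
    finally show ?thesis by (simp add: root_product_def Z_def m_def)
  qed
  \<comment> \<open>The number \<open>Suc d\<close> of sample points exceeds the degree
    \<open>d\<close>, so their average is the constant term.\<close>
  also have "poly p 0 = 1 / of_nat (Suc d) * (\<Sum>k<Suc d. poly p (of_real M * cis (2 * pi * real k / real (Suc d))))"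
    using sum_poly_roots_of_unity[of p "Suc d" "of_real M"] \<open>degree p = d\<close>
    by (simp del: of_nat_Suc sum.lessThan_Suc)
  also have "(\<Sum>k<Suc d. poly p (of_real M * cis (2 * pi * real k / real (Suc d)))) = (\<Sum>k<Suc d.
      (of_real M * cis (2 * pi * real k / real (Suc d))) ^ d *
      exp (log_integral \<rho> \<phi> (\<lambda>w. Ln (1 - \<psi> w / (of_real M * cis (2 * pi * real k / real (Suc d)))))))"
    using \<open>M > 0\<close> by (intro sum.cong refl exp_eq) (simp add: norm_mult)
  finally show ?thesis by (simp del: of_nat_Suc sum.lessThan_Suc)
qed

section \<open>Dependence of root products on parameters\<close>

context
  fixes \<rho> \<rho>' :: real
  assumes \<rho>: "0 < \<rho>" "\<rho> < \<rho>'"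
begin

lemma circlepath_in_ball: "circlepath 0 \<rho> x \<in> ball 0 \<rho>'" "cmod (circlepath 0 \<rho> x) = \<rho>"
  using \<rho> by (auto simp: circlepath norm_mult)

lemma log_integral_cbox:
  "log_integral \<rho> \<phi> \<kappa> = 1 / (2 * pi * \<i>) * integral (cbox 0 1)
    (\<lambda>x. deriv \<phi> (circlepath 0 \<rho> x) * \<kappa> (circlepath 0 \<rho> x) / \<phi> (circlepath 0 \<rho> x) *
      (2 * of_real pi * \<i> * of_real \<rho> * exp (2 * of_real pi * \<i> * of_real x)))"
  by (simp add: log_integral_def contour_integral_circlepath_cbox)

lemma continuous_on_log_integral_kernel:
  fixes \<Phi> \<kappa> :: "'a::t2_space \<Rightarrow> complex \<Rightarrow> complex"
  assumes \<Phi>: "continuous_on (Y \<times> ball 0 \<rho>') (\<lambda>(y,w). \<Phi> y w)" "\<And>y. y \<in> Y \<Longrightarrow> \<Phi> y holomorphic_on ball 0 \<rho>'"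
    and nz: "\<And>y w. y \<in> Y \<Longrightarrow> cmod w = \<rho> \<Longrightarrow> \<Phi> y w \<noteq> 0"
    and \<kappa>: "continuous_on (Y \<times> ball 0 \<rho>') (\<lambda>(y,w). \<kappa> y w)"
  shows "continuous_on (Y \<times> cbox 0 1) (\<lambda>(y,x). deriv (\<Phi> y) (circlepath 0 \<rho> x) * \<kappa> y (circlepath 0 \<rho> x) / \<Phi> y (circlepath 0 \<rho> x) *
      (2 * of_real pi * \<i> * of_real \<rho> * exp (2 * of_real pi * \<i> * of_real x)))"
proof -
  note D = continuous_on_deriv_parameter[OF \<Phi>(1) open_ball \<Phi>(2)]
  have [continuous_intros]: "continuous_on (Y \<times> cbox 0 (1::real)) (\<lambda>q. circlepath 0 \<rho> (snd q))"
    by (intro continuous_on_compose2[OF continuous_on_circlepath[of UNIV]] continuous_intros) auto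
  show ?thesis
    unfolding case_prod_beta
    by (intro continuous_intros continuous_on_compose_pair[OF D] continuous_on_compose_pair[OF \<Phi>(1)]
         continuous_on_compose_pair[OF \<kappa>])
       (use circlepath_in_ball nz in auto)
qed

lemma continuous_on_log_integral:
  fixes \<Phi> \<kappa> :: "'a::t2_space \<Rightarrow> complex \<Rightarrow> complex"
  assumes "continuous_on (Y \<times> ball 0 \<rho>') (\<lambda>(y,w). \<Phi> y w)" "\<And>y. y \<in> Y \<Longrightarrow> \<Phi> y holomorphic_on ball 0 \<rho>'"
    and "\<And>y w. y \<in> Y \<Longrightarrow> cmod w = \<rho> \<Longrightarrow> \<Phi> y w \<noteq> 0"
    and "continuous_on (Y \<times> ball 0 \<rho>') (\<lambda>(y,w). \<kappa> y w)"
  shows "continuous_on Y (\<lambda>y. log_integral \<rho> (\<Phi> y) (\<kappa> y))"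
  unfolding log_integral_cbox
  by (intro continuous_intros integral_continuous_on_param continuous_on_log_integral_kernel assms)

lemma holomorphic_on_log_integral:
  assumes \<Phi>: "continuous_on (Y \<times> ball 0 \<rho>') (\<lambda>(y,w). \<Phi> y w)" "\<And>y. y \<in> Y \<Longrightarrow> \<Phi> y holomorphic_on ball 0 \<rho>'"
    and nz: "\<And>y w. y \<in> Y \<Longrightarrow> cmod w = \<rho> \<Longrightarrow> \<Phi> y w \<noteq> 0"
    and \<kappa>: "continuous_on (Y \<times> ball 0 \<rho>') (\<lambda>(y,w). \<kappa> y w)"
    and Y: "open Y" "convex Y"
    and hol: "\<And>w. w \<in> ball 0 \<rho>' \<Longrightarrow> (\<lambda>y. \<Phi> y w) holomorphic_on Y" "\<And>w. w \<in> ball 0 \<rho>' \<Longrightarrow> (\<lambda>y. \<kappa> y w) holomorphic_on Y"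
  shows "(\<lambda>y. log_integral \<rho> (\<Phi> y) (\<kappa> y)) holomorphic_on Y"
  unfolding log_integral_cbox
proof (intro holomorphic_intros holomorphic_on_integral_parameter)
  show "continuous_on (Y \<times> cbox 0 1) (\<lambda>(y,x). deriv (\<Phi> y) (circlepath 0 \<rho> x) * \<kappa> y (circlepath 0 \<rho> x) / \<Phi> y (circlepath 0 \<rho> x) *
      (2 * of_real pi * \<i> * of_real \<rho> * exp (2 * of_real pi * \<i> * of_real x)))"
    by (rule continuous_on_log_integral_kernel[OF \<Phi> nz \<kappa>])
next
  fix t :: real assume "t \<in> cbox 0 1"
  show "(\<lambda>y. deriv (\<Phi> y) (circlepath 0 \<rho> t)) holomorphic_on Y"
    by (rule holomorphic_on_deriv_parameter[OF \<Phi>(1) Y open_ball _ \<Phi>(2) hol(1)])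
       (use circlepath_in_ball in auto)
  show "(\<lambda>y. \<kappa> y (circlepath 0 \<rho> t)) holomorphic_on Y" "(\<lambda>y. \<Phi> y (circlepath 0 \<rho> t)) holomorphic_on Y"
    using hol circlepath_in_ball(1) by auto
qed (use circlepath_in_ball nz Y in auto)

text \<open>With weight 1 the integral counts the roots, so it is a continuous function with integer
  values on a connected set.\<close>

lemma log_integral_one_constant:
  fixes \<Phi> :: "'a::t2_space \<Rightarrow> complex \<Rightarrow> complex"
  assumes \<Phi>: "continuous_on (Y \<times> ball 0 \<rho>') (\<lambda>(y,w). \<Phi> y w)" "\<And>y. y \<in> Y \<Longrightarrow> \<Phi> y holomorphic_on ball 0 \<rho>'"
    and nz: "\<And>y w. y \<in> Y \<Longrightarrow> cmod w = \<rho> \<Longrightarrow> \<Phi> y w \<noteq> 0" and "connected Y"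
  shows "\<exists>d. \<forall>y\<in>Y. of_nat d = log_integral \<rho> (\<Phi> y) (\<lambda>_. 1)"
proof (cases "Y = {}")
  case False
  then obtain y0 where y0: "y0 \<in> Y" by auto
  define N where "N = (\<lambda>y. \<Sum>\<alpha> | \<alpha> \<in> ball 0 \<rho> \<and> \<Phi> y \<alpha> = 0. nat (zorder (\<Phi> y) \<alpha>))"
  have N: "log_integral \<rho> (\<Phi> y) (\<lambda>_. 1) = of_nat (N y)" if "y \<in> Y" for y
    using contour_integral_log_derivative[OF \<rho> \<Phi>(2)[OF that] nz[OF that], of "\<lambda>_. 1"]
    by (simp add: log_integral_def N_def)
  have "continuous_on Y (\<lambda>y. log_integral \<rho> (\<Phi> y) (\<lambda>_. 1))"
    by (rule continuous_on_log_integral[OF \<Phi> nz]) (auto simp: case_prod_beta)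
  then have "(\<lambda>y. log_integral \<rho> (\<Phi> y) (\<lambda>_. 1)) constant_on Y"
  proof (rule continuous_discrete_range_constant[OF \<open>connected Y\<close>])
    fix x assume "x \<in> Y"
    have "1 \<le> cmod (of_nat (N y) - of_nat (N x))" if "complex_of_nat (N y) \<noteq> of_nat (N x)" for y
    proof -
      have "complex_of_nat (N y) - of_nat (N x) = of_int (int (N y) - int (N x))" by simp
      moreover have "cmod (of_int (int (N y) - int (N x))) \<ge> 1"
        unfolding norm_of_int using that by simp
      ultimately show ?thesis by metis
    qed
    then show "\<exists>e>0. \<forall>y. y \<in> Y \<and> log_integral \<rho> (\<Phi> y) (\<lambda>_. 1) \<noteq> log_integral \<rho> (\<Phi> x) (\<lambda>_. 1) \<longrightarrow>
        e \<le> norm (log_integral \<rho> (\<Phi> y) (\<lambda>_. 1) - log_integral \<rho> (\<Phi> x) (\<lambda>_. 1))"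
      using N \<open>x \<in> Y\<close> by (intro exI[of _ 1]) auto
  qed
  then show ?thesis using N[OF y0] y0 unfolding constant_on_def by metis
qed auto

lemma Ln_one_minus:
  fixes z \<tau> :: complex
  assumes "cmod z < M" "cmod \<tau> = M"
  shows "1 - z / \<tau> \<notin> \<real>\<^sub>\<le>\<^sub>0"
proof -
  have "M > 0" using assms(1) norm_ge_zero[of z] by linarith
  then have "cmod (z / \<tau>) < 1" using assms by (simp add: norm_divide)
  then show ?thesis using complex_Re_le_cmod[of "z / \<tau>"] by (auto simp: complex_nonpos_Reals_iff)
qed

text \<open>As the number \<open>d\<close> of roots does not vary, \<open>root_product_eq\<close>
  expresses the product by one fixed formula in finitely many log integrals, each continuous in the
  parameter.\<close>

lemma continuous_on_root_product:
  fixes \<Phi> \<Psi> :: "'a::t2_space \<Rightarrow> complex \<Rightarrow> complex"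
  assumes \<Phi>: "continuous_on (Y \<times> ball 0 \<rho>') (\<lambda>(y,w). \<Phi> y w)" "\<And>y. y \<in> Y \<Longrightarrow> \<Phi> y holomorphic_on ball 0 \<rho>'"
    and nz: "\<And>y w. y \<in> Y \<Longrightarrow> cmod w = \<rho> \<Longrightarrow> \<Phi> y w \<noteq> 0" and "connected Y"
    and \<Psi>: "continuous_on (Y \<times> ball 0 \<rho>') (\<lambda>(y,w). \<Psi> y w)" "\<And>y. y \<in> Y \<Longrightarrow> \<Psi> y holomorphic_on ball 0 \<rho>'"
    and bound: "\<And>y w. y \<in> Y \<Longrightarrow> w \<in> ball 0 \<rho>' \<Longrightarrow> cmod (\<Psi> y w) < M"
  shows "continuous_on Y (\<lambda>y. root_product \<rho> (\<Phi> y) (\<Psi> y))"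
proof (cases "Y = {}")
  case False
  then have "M > 0" using bound[of _ 0] \<rho> norm_ge_zero
    by (metis all_not_in_conv centre_in_ball order_le_less_trans order_less_trans)
  obtain d where d: "\<And>y. y \<in> Y \<Longrightarrow> of_nat d = log_integral \<rho> (\<Phi> y) (\<lambda>_. 1)"
    using log_integral_one_constant[OF \<Phi> nz \<open>connected Y\<close>] by blast
  have "continuous_on (Y \<times> ball 0 \<rho>') (\<lambda>(y, w). Ln (1 - \<Psi> y w / \<tau>))" if "cmod \<tau> = M" for \<tau>
    unfolding case_prod_beta
    by (intro continuous_intros continuous_on_compose_pair[OF \<Psi>(1)])
       (use Ln_one_minus[OF bound that] that \<open>M > 0\<close> in auto)
  then have "continuous_on Y (\<lambda>y. log_integral \<rho> (\<Phi> y) (\<lambda>w. Ln (1 - \<Psi> y w / \<tau>)))" if "cmod \<tau> = M" for \<tau>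
    using that by (intro continuous_on_log_integral[OF \<Phi> nz])
  then show ?thesis
    using \<open>M > 0\<close> by (subst continuous_on_cong[OF refl root_product_eq[OF \<rho> \<Phi>(2) nz \<Psi>(2) bound d]])
      (auto intro!: continuous_intros simp: norm_mult simp del: of_nat_Suc sum.lessThan_Suc)
qed auto

text \<open>The same formula, now with holomorphic log integrals; convexity of \<open>Y\<close> also
  gives the connectedness that fixes the number of roots.\<close>

lemma holomorphic_on_root_product:
  assumes \<Phi>: "continuous_on (Y \<times> ball 0 \<rho>') (\<lambda>(y,w). \<Phi> y w)" "\<And>y. y \<in> Y \<Longrightarrow> \<Phi> y holomorphic_on ball 0 \<rho>'"
    and nz: "\<And>y w. y \<in> Y \<Longrightarrow> cmod w = \<rho> \<Longrightarrow> \<Phi> y w \<noteq> 0" and Y: "open Y" "convex Y"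
    and \<Psi>: "continuous_on (Y \<times> ball 0 \<rho>') (\<lambda>(y,w). \<Psi> y w)" "\<And>y. y \<in> Y \<Longrightarrow> \<Psi> y holomorphic_on ball 0 \<rho>'"
    and bound: "\<And>y w. y \<in> Y \<Longrightarrow> w \<in> ball 0 \<rho>' \<Longrightarrow> cmod (\<Psi> y w) < M"
    and hol: "\<And>w. w \<in> ball 0 \<rho>' \<Longrightarrow> (\<lambda>y. \<Phi> y w) holomorphic_on Y" "\<And>w. w \<in> ball 0 \<rho>' \<Longrightarrow> (\<lambda>y. \<Psi> y w) holomorphic_on Y"
  shows "(\<lambda>y. root_product \<rho> (\<Phi> y) (\<Psi> y)) holomorphic_on Y"
proof (cases "Y = {}")
  case False
  then have "M > 0" using bound[of _ 0] \<rho> norm_ge_zero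
    by (metis all_not_in_conv centre_in_ball order_le_less_trans order_less_trans)
  obtain d where d: "\<And>y. y \<in> Y \<Longrightarrow> of_nat d = log_integral \<rho> (\<Phi> y) (\<lambda>_. 1)"
    using log_integral_one_constant[OF \<Phi> nz convex_connected[OF Y(2)]] by blast
  have "continuous_on (Y \<times> ball 0 \<rho>') (\<lambda>(y, w). Ln (1 - \<Psi> y w / \<tau>))" if "cmod \<tau> = M" for \<tau>
    unfolding case_prod_beta
    by (intro continuous_intros continuous_on_compose_pair[OF \<Psi>(1)])
       (use Ln_one_minus[OF bound that] that \<open>M > 0\<close> in auto)
  moreover have "(\<lambda>y. Ln (1 - \<Psi> y w / \<tau>)) holomorphic_on Y" if "cmod \<tau> = M" "w \<in> ball 0 \<rho>'" for \<tau> w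
    by (intro holomorphic_intros hol(2) that(2))
       (use Ln_one_minus[OF bound that(1)] that \<open>M > 0\<close> in auto)
  ultimately have "(\<lambda>y. log_integral \<rho> (\<Phi> y) (\<lambda>w. Ln (1 - \<Psi> y w / \<tau>))) holomorphic_on Y" if "cmod \<tau> = M" for \<tau>
    using that by (intro holomorphic_on_log_integral[OF \<Phi> nz _ Y hol(1)])
  then show ?thesis
    using \<open>M > 0\<close> by (subst holomorphic_cong[OF refl root_product_eq[OF \<rho> \<Phi>(2) nz \<Psi>(2) bound d]])
      (auto intro!: holomorphic_intros simp: norm_mult simp del: of_nat_Suc sum.lessThan_Suc)
qed (simp add: holomorphic_on_def)

end

subsection \<open>Elimination of variables\<close>

inductive_set linear_combinations :: "('a \<Rightarrow> complex) set \<Rightarrow> ('a \<Rightarrow> complex) set" for FF where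
  base: "f \<in> FF \<Longrightarrow> f \<in> linear_combinations FF"
| step: "h \<in> linear_combinations FF \<Longrightarrow> f \<in> FF \<Longrightarrow> (\<lambda>x. h x + c * f x) \<in> linear_combinations FF"

lemma linear_combinations_nonvanishing:
  assumes "finite P" "FF \<noteq> {}" "\<And>p. p \<in> P \<Longrightarrow> \<exists>f\<in>FF. f p \<noteq> 0"
  shows "\<exists>h\<in>linear_combinations FF. \<forall>p\<in>P. h p \<noteq> 0"
  using assms(1,3)
proof (induction P rule: finite_induct)
  case empty
  then show ?case using assms(2) by (auto intro: linear_combinations.base)
next
  case (insert x P)
  then obtain h where h: "h \<in> linear_combinations FF" "\<And>p. p \<in> P \<Longrightarrow> h p \<noteq> 0" by auto
  obtain f where f: "f \<in> FF" "f x \<noteq> 0" using insert.prems by auto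
  \<comment> \<open>Adding \<open>c * f\<close> creates a zero at \<open>p\<close> only if
    \<open>c\<close> is the ratio \<open>- h p / f p\<close>; finitely many values are excluded, so
    a good \<open>c\<close> exists.\<close>
  have "finite ((\<lambda>p. - h p / f p) ` insert x P)" using insert.hyps by auto
  then obtain c where c: "c \<notin> (\<lambda>p. - h p / f p) ` insert x P"
    using infinite_UNIV_char_0 by (metis ex_new_if_finite)
  have "h p + c * f p \<noteq> 0" if p: "p \<in> insert x P" for p
  proof (cases "f p = 0")
    case True
    then show ?thesis using p f h(2) by auto
  next
    case False
    then show ?thesis using c p by (auto simp: image_iff field_simps add_eq_0_iff)
  qed
  then show ?case using linear_combinations.step[OF h(1) f(1), of c] by (intro bexI) auto
qed

lemma linear_combinations_vanishing:
  assumes "h \<in> linear_combinations FF" "\<And>f. f \<in> FF \<Longrightarrow> f p = 0"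
  shows "h p = 0"
  using assms by induction auto

section \<open>Complex lines and resultants along them\<close>

lemma continuous_on_smult [continuous_intros]:
  fixes b :: "complex^'n"
  shows "continuous_on S f \<Longrightarrow> continuous_on S (\<lambda>x. f x *s b)"
  unfolding vector_scalar_mult_def by (intro continuous_intros)

lemma norm_smult:
  fixes b :: "complex^'n"
  shows "norm (c *s b) = cmod c * norm b"
  by (simp add: norm_vec_def norm_mult L2_set_right_distrib)

lemma convex_line_preimage:
  fixes a b :: "complex^'n"
  assumes "convex S"
  shows "convex {\<zeta>. a + \<zeta> *s b \<in> S}"
proof (rule convexI)
  fix x y :: complex and u v :: real
  assume "x \<in> {\<zeta>. a + \<zeta> *s b \<in> S}" "y \<in> {\<zeta>. a + \<zeta> *s b \<in> S}" "0 \<le> u" "0 \<le> v" "u + v = 1"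
  then have *: "a + x *s b \<in> S" "a + y *s b \<in> S" "0 \<le> u" "0 \<le> v" "u + v = 1" by auto
  have "u *\<^sub>R (a + x *s b) + v *\<^sub>R (a + y *s b) = (u + v) *\<^sub>R a + (u *\<^sub>R x + v *\<^sub>R y) *s b"
    by (simp add: vec_eq_iff algebra_simps scaleR_conv_of_real[where 'a = complex])
  then show "u *\<^sub>R x + v *\<^sub>R y \<in> {\<zeta>. a + \<zeta> *s b \<in> S}"
    using convexD[OF assms *] * by simp
qed

lemma open_line_preimage:
  fixes a b :: "complex^'n"
  assumes "open S"
  shows "open {\<zeta>. a + \<zeta> *s b \<in> S}"
proof -
  have "continuous_on UNIV (\<lambda>\<zeta>. a + \<zeta> *s b)" by (intro continuous_intros)
  from open_vimage[OF assms this] show ?thesis by (simp add: vimage_def)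
qed

text \<open>Holomorphy is encoded as continuity together with holomorphy in \<open>s\<close> and
  along every complex line in \<open>z\<close>, since these are properties that resultants inherit
  from the one-variable parameter lemmas.\<close>

definition holomorphic_pair :: "real \<Rightarrow> (complex \<times> (complex^'n) \<Rightarrow> complex) \<Rightarrow> bool" where
  "holomorphic_pair \<rho> f \<longleftrightarrow> continuous_on (ball 0 \<rho> \<times> ball 0 \<rho>) f \<and>
     (\<forall>z\<in>ball 0 \<rho>. (\<lambda>s. f (s, z)) holomorphic_on ball 0 \<rho>) \<and>
     (\<forall>s\<in>ball 0 \<rho>. \<forall>a b. (\<lambda>\<zeta>. f (s, a + \<zeta> *s b)) holomorphic_on {\<zeta>. a + \<zeta> *s b \<in> ball 0 \<rho>})"

lemma holomorphic_pair_linear_combinations: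
  assumes "h \<in> linear_combinations FF" "\<And>f. f \<in> FF \<Longrightarrow> holomorphic_pair \<rho> f"
  shows "holomorphic_pair \<rho> h"
  using assms
  by induction (auto simp: holomorphic_pair_def intro!: continuous_intros holomorphic_intros)

text \<open>Eliminates the direction \<open>b\<close>: the zeros of \<open>f\<close> on the line
  through \<open>z\<close> are multiplied out. The argument \<open>z\<close> keeps its type and is
  later restricted to a smaller coordinate subspace.\<close>

definition root_resultant where
  "root_resultant r f b h = (\<lambda>(s, z). root_product r (\<lambda>w. f (s, z + w *s b)) (\<lambda>w. h (s, z + w *s b)))"

text \<open>Each of the three clauses is an instance of the parameter lemmas for root products, with
  discs of radii \<open>r < 2 * r\<close> in the variable \<open>w\<close>.\<close>

lemma holomorphic_pair_root_resultant:
  fixes f h :: "complex \<times> (complex^'n) \<Rightarrow> complex"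
  assumes f: "holomorphic_pair \<rho> f" and h: "holomorphic_pair \<rho> h" and b: "norm b = 1"
    and r: "0 < r" "4 * r \<le> \<rho>" and \<epsilon>: "4 * \<epsilon> \<le> \<rho>"
    and nz: "\<And>s z w. s \<in> ball 0 \<epsilon> \<Longrightarrow> z \<in> ball 0 \<epsilon> \<Longrightarrow> cmod w = r \<Longrightarrow> f (s, z + w *s b) \<noteq> 0"
  shows "holomorphic_pair \<epsilon> (root_resultant r f b h)"
proof -
  have \<rho>: "0 < \<rho>" using r by linarith
  \<comment> \<open>For \<open>norm z < \<rho>/4\<close> and
    \<open>cmod w < 2 * r \<le> \<rho>/2\<close> the point \<open>z + w *s b\<close> has norm at
    most \<open>3*\<rho>/4\<close>; compactness bounds \<open>h\<close> there, as the root product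
    formula requires.\<close>
  have "compact (h ` (cball 0 (\<rho>/4) \<times> cball 0 (3*\<rho>/4)))"
  proof (rule compact_continuous_image)
    have "cball 0 (\<rho>/4) \<times> cball 0 (3*\<rho>/4) \<subseteq> ball (0::complex) \<rho> \<times> ball (0::complex^'n) \<rho>"
      using \<rho> by auto
    then show "continuous_on (cball 0 (\<rho>/4) \<times> cball 0 (3*\<rho>/4)) h"
      using h unfolding holomorphic_pair_def by (meson continuous_on_subset)
  qed (intro compact_Times compact_cball)
  then have "bounded (h ` (cball 0 (\<rho>/4) \<times> cball 0 (3*\<rho>/4)))" by (rule compact_imp_bounded)
  then obtain M where "\<forall>x\<in>h ` (cball 0 (\<rho>/4) \<times> cball 0 (3*\<rho>/4)). cmod x \<le> M"
    unfolding bounded_iff ..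
  then have M: "cmod (h (s,z)) \<le> M" if "s \<in> cball 0 (\<rho>/4)" "z \<in> cball 0 (3*\<rho>/4)" for s z
    using that by blast
  have dom: "z + w *s b \<in> ball 0 \<rho>" "z + w *s b \<in> cball 0 (3*\<rho>/4)" if "z \<in> ball 0 \<epsilon>" "w \<in> ball 0 (2*r)" for z w
  proof -
    have "norm (z + w *s b) \<le> norm z + cmod w"
      using norm_triangle_ineq[of z "w *s b"] b by (simp add: norm_smult)
    also have "\<dots> \<le> 3*\<rho>/4" using that r \<epsilon> by simp
    finally show "z + w *s b \<in> ball 0 \<rho>" "z + w *s b \<in> cball 0 (3*\<rho>/4)" using \<rho> by auto
  qed
  have dom1: "s \<in> ball 0 \<rho>" "s \<in> cball 0 (\<rho>/4)" if "s \<in> ball 0 \<epsilon>" for s :: complex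
    using that \<epsilon> \<rho> by auto
  have bound: "cmod (h (s, z + w *s b)) < M + 1" if "s \<in> ball 0 \<epsilon>" "z \<in> ball 0 \<epsilon>" "w \<in> ball 0 (2*r)" for s z w
    using M[OF dom1(2) dom(2)] that by (smt (verit))
  have r2: "0 < r" "r < 2 * r" using r by auto
  have cont: "continuous_on (S \<times> ball 0 (2*r)) (\<lambda>(y,w). g (p y, q y + w *s b))"
    if "holomorphic_pair \<rho> g" "continuous_on S p" "continuous_on S q" "\<And>y. y \<in> S \<Longrightarrow> p y \<in> ball 0 \<epsilon>"
      "\<And>y. y \<in> S \<Longrightarrow> q y \<in> ball 0 \<epsilon>" for g S and p :: "'x::topological_space \<Rightarrow> complex" and q :: "'x \<Rightarrow> complex^'n"
  proof -
    have "continuous_on (ball 0 \<rho> \<times> ball 0 \<rho>) (\<lambda>(s,z). g (s,z))"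
      using that(1) by (simp add: holomorphic_pair_def case_prod_beta)
    then have "continuous_on (S \<times> ball 0 (2*r)) (\<lambda>x. g (p (fst x), q (fst x) + snd x *s b))"
    proof (rule continuous_on_compose_pair)
      show "continuous_on (S \<times> ball 0 (2*r)) (\<lambda>x. p (fst x))"
        by (rule continuous_on_compose2[OF that(2) continuous_on_fst[OF continuous_on_id]]) auto
      show "continuous_on (S \<times> ball 0 (2*r)) (\<lambda>x. q (fst x) + snd x *s b)"
        by (intro continuous_intros continuous_on_compose2[OF that(3) continuous_on_fst[OF continuous_on_id]]) auto
      show "p (fst x) \<in> ball 0 \<rho>" "q (fst x) + snd x *s b \<in> ball 0 \<rho>" if "x \<in> S \<times> ball 0 (2*r)" for x
        using that dom1(1) dom(1) \<open>\<And>y. y \<in> S \<Longrightarrow> p y \<in> ball 0 \<epsilon>\<close> \<open>\<And>y. y \<in> S \<Longrightarrow> q y \<in> ball 0 \<epsilon>\<close>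
        by (simp_all only: mem_Times_iff)
    qed
    then show ?thesis by (simp only: case_prod_beta')
  qed
  have holw: "(\<lambda>w. g (s, z + w *s b)) holomorphic_on ball 0 (2*r)"
    if "holomorphic_pair \<rho> g" "s \<in> ball 0 \<epsilon>" "z \<in> ball 0 \<epsilon>" for g s z
  proof -
    have "(\<lambda>w. g (s, z + w *s b)) holomorphic_on {w. z + w *s b \<in> ball 0 \<rho>}"
      using that dom1 unfolding holomorphic_pair_def by blast
    then show ?thesis
      by (rule holomorphic_on_subset) (use dom(1)[OF that(3)] in blast)
  qed
  have hols: "(\<lambda>s. g (s, z + w *s b)) holomorphic_on ball 0 \<epsilon>"
    if "holomorphic_pair \<rho> g" "z \<in> ball 0 \<epsilon>" "w \<in> ball 0 (2*r)" for g z w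
  proof -
    have "(\<lambda>s. g (s, z + w *s b)) holomorphic_on ball 0 \<rho>"
      using that dom unfolding holomorphic_pair_def by blast
    then show ?thesis
      by (rule holomorphic_on_subset) (use dom1(1) in blast)
  qed
  have holl: "(\<lambda>\<zeta>. g (s, (a + \<zeta> *s c) + w *s b)) holomorphic_on {\<zeta>. a + \<zeta> *s c \<in> ball 0 \<epsilon>}"
    if "holomorphic_pair \<rho> g" "s \<in> ball 0 \<epsilon>" "w \<in> ball 0 (2*r)" for g s w a c
  proof -
    have "(\<lambda>\<zeta>. g (s, (a + w *s b) + \<zeta> *s c)) holomorphic_on {\<zeta>. (a + w *s b) + \<zeta> *s c \<in> ball 0 \<rho>}"
      using that dom1 unfolding holomorphic_pair_def by blast
    then have "(\<lambda>\<zeta>. g (s, (a + w *s b) + \<zeta> *s c)) holomorphic_on {\<zeta>. a + \<zeta> *s c \<in> ball 0 \<epsilon>}"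
    proof (rule holomorphic_on_subset, intro subsetI CollectI)
      fix \<zeta> assume "\<zeta> \<in> {\<zeta>. a + \<zeta> *s c \<in> ball 0 \<epsilon>}"
      then show "a + w *s b + \<zeta> *s c \<in> ball 0 \<rho>"
        using dom(1)[OF _ that(3), of "a + \<zeta> *s c"] by (simp add: add_ac)
    qed
    then show ?thesis by (simp add: add_ac)
  qed
  have "continuous_on (ball 0 \<epsilon> \<times> ball 0 \<epsilon>) (root_resultant r f b h)"
    unfolding root_resultant_def case_prod_beta
  proof (rule continuous_on_root_product[OF r2, where M = "M + 1"])
    show "continuous_on ((ball 0 \<epsilon> \<times> ball 0 \<epsilon>) \<times> ball 0 (2 * r)) (\<lambda>(y, w). f (fst y, snd y + w *s b))"
      by (rule cont[OF f]) (auto intro!: continuous_intros)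
    show "continuous_on ((ball 0 \<epsilon> \<times> ball 0 \<epsilon>) \<times> ball 0 (2 * r)) (\<lambda>(y, w). h (fst y, snd y + w *s b))"
      by (rule cont[OF h]) (auto intro!: continuous_intros)
    show "connected (ball (0::complex) \<epsilon> \<times> ball (0::complex^'n) \<epsilon>)"
      by (intro convex_connected convex_Times convex_ball)
  next
    fix y :: "complex \<times> (complex^'n)" assume y: "y \<in> ball 0 \<epsilon> \<times> ball 0 \<epsilon>"
    show "(\<lambda>w. f (fst y, snd y + w *s b)) holomorphic_on ball 0 (2 * r)"
      "(\<lambda>w. h (fst y, snd y + w *s b)) holomorphic_on ball 0 (2 * r)"
      by (rule holw[OF f] holw[OF h]; use y in auto)+
    show "f (fst y, snd y + w *s b) \<noteq> 0" if "cmod w = r" for w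
      by (rule nz) (use y that in auto)
    show "cmod (h (fst y, snd y + w *s b)) < M + 1" if "w \<in> ball 0 (2 * r)" for w
      by (rule bound) (use y that in auto)
  qed
  moreover have "(\<lambda>s. root_resultant r f b h (s, z)) holomorphic_on ball 0 \<epsilon>" if z: "z \<in> ball 0 \<epsilon>" for z
    unfolding root_resultant_def case_prod_conv
  proof (rule holomorphic_on_root_product[OF r2, where M = "M + 1"])
    show "continuous_on (ball 0 \<epsilon> \<times> ball 0 (2 * r)) (\<lambda>(y, w). f (y, z + w *s b))"
      by (rule cont[OF f]) (use z in \<open>auto intro!: continuous_intros\<close>)
    show "continuous_on (ball 0 \<epsilon> \<times> ball 0 (2 * r)) (\<lambda>(y, w). h (y, z + w *s b))"
      by (rule cont[OF h]) (use z in \<open>auto intro!: continuous_intros\<close>)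
  next
    fix w :: complex assume w: "w \<in> ball 0 (2 * r)"
    show "(\<lambda>y. f (y, z + w *s b)) holomorphic_on ball 0 \<epsilon>" "(\<lambda>y. h (y, z + w *s b)) holomorphic_on ball 0 \<epsilon>"
      by (rule hols[OF f z w] hols[OF h z w])+
  next
    fix y :: complex assume y: "y \<in> ball 0 \<epsilon>"
    show "(\<lambda>w. f (y, z + w *s b)) holomorphic_on ball 0 (2 * r)"
      "(\<lambda>w. h (y, z + w *s b)) holomorphic_on ball 0 (2 * r)"
      by (rule holw[OF f y z] holw[OF h y z])+
    show "f (y, z + w *s b) \<noteq> 0" if "cmod w = r" for w
      by (rule nz[OF y z that])
    show "cmod (h (y, z + w *s b)) < M + 1" if "w \<in> ball 0 (2 * r)" for w
      by (rule bound[OF y z that])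
  qed auto
  moreover have "(\<lambda>\<zeta>. root_resultant r f b h (s, a + \<zeta> *s c)) holomorphic_on {\<zeta>. a + \<zeta> *s c \<in> ball 0 \<epsilon>}"
    (is "_ holomorphic_on ?Y") if s: "s \<in> ball 0 \<epsilon>" for s a c
    unfolding root_resultant_def case_prod_conv
  proof (rule holomorphic_on_root_product[OF r2, where M = "M + 1"])
    show "continuous_on (?Y \<times> ball 0 (2 * r)) (\<lambda>(y, w). f (s, a + y *s c + w *s b))"
      by (rule cont[OF f]) (use s in \<open>auto intro!: continuous_intros\<close>)
    show "continuous_on (?Y \<times> ball 0 (2 * r)) (\<lambda>(y, w). h (s, a + y *s c + w *s b))"
      by (rule cont[OF h]) (use s in \<open>auto intro!: continuous_intros\<close>)
    show "open ?Y" "convex ?Y"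
      by (intro open_line_preimage open_ball convex_line_preimage convex_ball)+
  next
    fix w :: complex assume w: "w \<in> ball 0 (2 * r)"
    show "(\<lambda>y. f (s, a + y *s c + w *s b)) holomorphic_on ?Y" "(\<lambda>y. h (s, a + y *s c + w *s b)) holomorphic_on ?Y"
      by (rule holl[OF f s w] holl[OF h s w])+
  next
    fix y :: complex assume "y \<in> ?Y"
    then have y: "a + y *s c \<in> ball 0 \<epsilon>" by simp
    show "(\<lambda>w. f (s, a + y *s c + w *s b)) holomorphic_on ball 0 (2 * r)"
      "(\<lambda>w. h (s, a + y *s c + w *s b)) holomorphic_on ball 0 (2 * r)"
      by (rule holw[OF f s y] holw[OF h s y])+
    show "f (s, a + y *s c + w *s b) \<noteq> 0" if "cmod w = r" for w
      by (rule nz[OF s y that])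
    show "cmod (h (s, a + y *s c + w *s b)) < M + 1" if "w \<in> ball 0 (2 * r)" for w
      by (rule bound[OF s y that])
  qed
  ultimately show ?thesis unfolding holomorphic_pair_def by blast
qed

text \<open>If the line carries no common zero, then each of the finitely many roots of
  \<open>f\<close> is missed by some member of \<open>FF\<close>. One linear combination is then
  nonzero at all these roots, and so is its resultant with \<open>f\<close>.\<close>

lemma root_resultants_vanish_iff:
  fixes f :: "complex \<times> (complex^'n) \<Rightarrow> complex"
  assumes f: "f \<in> FF" and r: "0 < r" "r < r'"
    and hol: "(\<lambda>w. f (s, z + w *s b)) holomorphic_on ball 0 r'"
    and nz: "\<And>w. cmod w = r \<Longrightarrow> f (s, z + w *s b) \<noteq> 0"
  shows "(\<forall>h\<in>linear_combinations FF. root_resultant r f b h (s, z) = 0) \<longleftrightarrow>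
    (\<exists>w\<in>ball 0 r. \<forall>g\<in>FF. g (s, z + w *s b) = 0)"
proof -
  note iff = root_product_eq_0_iff[OF r hol nz]
  show ?thesis
  proof
    assume L: "\<forall>h\<in>linear_combinations FF. root_resultant r f b h (s, z) = 0"
    show "\<exists>w\<in>ball 0 r. \<forall>g\<in>FF. g (s, z + w *s b) = 0"
    proof (rule ccontr)
      assume neg: "\<not> ?thesis"
      define P where "P = (\<lambda>w. (s, z + w *s b)) ` {w \<in> ball 0 r. f (s, z + w *s b) = 0}"
      have "finite {w \<in> ball 0 r. f (s, z + w *s b) = 0}"
        using finite_roots[OF r hol nz r(2)] by (rule finite_subset[rotated]) auto
      then have "finite P" by (simp add: P_def)
      moreover have "\<exists>g\<in>FF. g p \<noteq> 0" if "p \<in> P" for p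
        using neg that by (auto simp: P_def)
      ultimately obtain h where h: "h \<in> linear_combinations FF" "\<And>p. p \<in> P \<Longrightarrow> h p \<noteq> 0"
        using linear_combinations_nonvanishing[of P FF] f by blast
      have "h (s, z + w *s b) \<noteq> 0" if "w \<in> ball 0 r" "f (s, z + w *s b) = 0" for w
        using that h(2) unfolding P_def by blast
      then have "root_resultant r f b h (s, z) \<noteq> 0"
        by (auto simp: root_resultant_def iff)
      then show False using L h by blast
    qed
  next
    assume "\<exists>w\<in>ball 0 r. \<forall>g\<in>FF. g (s, z + w *s b) = 0"
    then show "\<forall>h\<in>linear_combinations FF. root_resultant r f b h (s, z) = 0"
      using f linear_combinations_vanishing[of _ FF] by (auto simp: root_resultant_def iff)
  qed
qed


section \<open>Induction on the number of variables\<close>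

definition coordinate_subspace :: "'n set \<Rightarrow> (complex^'n) set" where
  "coordinate_subspace J = {z. \<forall>i. i \<notin> J \<longrightarrow> z $ i = 0}"

text \<open>Resultants remove one coordinate after another until only \<open>s\<close> remains,
  where a holomorphic function vanishes identically or has isolated zeros. So when the origin is
  isolated in the fibre \<open>s = 0\<close>, the local projection of the zero set to the
  \<open>s\<close>-axis is trivial or covers a disc.\<close>

lemma elimination:
  fixes FF :: "(complex \<times> (complex^'n) \<Rightarrow> complex) set" and J :: "'n set"
  assumes "\<rho> > 0" "\<And>f. f \<in> FF \<Longrightarrow> holomorphic_pair \<rho> f"
    and "\<And>z. z \<in> coordinate_subspace J \<Longrightarrow> norm z < \<rho> \<Longrightarrow> (\<And>f. f \<in> FF \<Longrightarrow> f (0, z) = 0) \<Longrightarrow> z = 0"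
    and "r > 0"
  shows "\<exists>\<epsilon>>0. (\<forall>s z. 0 < cmod s \<and> cmod s < \<epsilon> \<and> norm z < \<epsilon> \<and> z \<in> coordinate_subspace J \<longrightarrow> (\<exists>f\<in>FF. f (s, z) \<noteq> 0)) \<or>
    (\<forall>s. cmod s < \<epsilon> \<longrightarrow> (\<exists>z\<in>coordinate_subspace J. norm z < r \<and> (\<forall>f\<in>FF. f (s, z) = 0)))"
  using finite[of J] assms
proof (induction J arbitrary: FF \<rho> r rule: finite_psubset_induct)
  case (psubset J)
  note \<rho> = \<open>\<rho> > 0\<close> and hol = psubset.prems(2) and only = psubset.prems(3) and r = \<open>r > 0\<close>
  show ?case
  proof (cases "J = {}")
    case True
    have z: "z \<in> coordinate_subspace J \<longleftrightarrow> z = 0" for z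
      by (auto simp: True coordinate_subspace_def vec_eq_iff)
    show ?thesis
    \<comment> \<open>No coordinate is left: either all functions vanish identically in
      \<open>s\<close>, or one of them has no zero in a punctured disc.\<close>
    proof (cases "\<forall>f\<in>FF. \<forall>s. cmod s < \<rho> \<longrightarrow> f (s, 0) = 0")
      case True
      then show ?thesis using \<rho> r z by (intro exI[of _ \<rho>]) auto
    next
      case False
      then obtain f s0 where f: "f \<in> FF" "cmod s0 < \<rho>" "f (s0, 0) \<noteq> 0" by auto
      have "(\<lambda>s. f (s, 0)) holomorphic_on ball 0 \<rho>"
        using hol[OF f(1)] \<rho> by (auto simp: holomorphic_pair_def)
      from non_zero_neighbour_alt[OF this _ _ _ _ f(3), of 0]
      have "\<forall>\<^sub>F s in at 0. f (s, 0) \<noteq> 0 \<and> s \<in> ball 0 \<rho>"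
        using \<rho> f by auto
      then obtain d where d: "d > 0" "\<And>s. s \<noteq> 0 \<Longrightarrow> cmod s < d \<Longrightarrow> f (s, 0) \<noteq> 0"
        unfolding eventually_at by (auto simp: dist_norm)
      then show ?thesis using f(1) z by (intro exI[of _ d]) auto
    qed
  next
    case False
    then obtain j where j: "j \<in> J" by auto
    define b :: "complex^'n" where "b = axis j 1"
    have nb: "norm b = 1" by (simp add: b_def norm_axis_1)
    have bJ: "w *s b \<in> coordinate_subspace J" for w
      using j by (auto simp: coordinate_subspace_def b_def axis_def)
    \<comment> \<open>This point of the \<open>j\<close>-th axis is not the origin, so by isolation
      some \<open>f\<close> in \<open>FF\<close> does not vanish identically on the axis over
      \<open>s = 0\<close>.\<close>
    have "norm (of_real (\<rho>/2) *s b) < \<rho>" "of_real (\<rho>/2) *s b \<noteq> 0"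
      using \<rho> nb by (auto simp: norm_smult simp del: of_real_divide)
    then obtain f where f: "f \<in> FF" "f (0, of_real (\<rho>/2) *s b) \<noteq> 0"
      using only[OF bJ] by blast
    have f_line: "(\<lambda>w. f (0, 0 + w *s b)) holomorphic_on ball 0 \<rho>"
    proof -
      have "(\<lambda>w. f (0, 0 + w *s b)) holomorphic_on {w. 0 + w *s b \<in> ball 0 \<rho>}"
        using hol[OF f(1)] \<rho> unfolding holomorphic_pair_def by (meson centre_in_ball)
      then show ?thesis by (simp add: norm_smult nb ball_def)
    qed
    have "\<forall>\<^sub>F w in at 0. f (0, 0 + w *s b) \<noteq> 0 \<and> w \<in> ball 0 \<rho>"
      using non_zero_neighbour_alt[OF f_line, of 0 "of_real (\<rho>/2)"] f(2) \<rho> by simp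
    then obtain d where d: "d > 0" "\<And>w. w \<noteq> 0 \<Longrightarrow> cmod w < d \<Longrightarrow> f (0, w *s b) \<noteq> 0"
      unfolding eventually_at by (auto simp: dist_norm)
    \<comment> \<open>Below \<open>d\<close>, the circle of radius \<open>r1\<close> avoids the
      zeros of \<open>f\<close> on the axis; the bounds by \<rho> and \<open>r\<close> keep lines
      inside the domain and lifted points small.\<close>
    define r1 where "r1 = min d (min r \<rho>) / 4"
    have r1: "0 < r1" "r1 < d" "4 * r1 \<le> \<rho>" "4 * r1 \<le> r"
      using d(1) r \<rho> by (auto simp: r1_def)
    \<comment> \<open>A tube argument: the zeros of \<open>f\<close> with \<open>cmod w = r1\<close>
      form a compact set whose projection to \<open>(s, z)\<close> misses the origin, so
      \<open>f\<close> has no zero on the circle for all small \<open>(s, z)\<close>.\<close>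
    define C where "C = {p \<in> (cball 0 (\<rho>/4) \<times> cball 0 (\<rho>/4)) \<times> sphere 0 r1. f (fst (fst p), snd (fst p) + snd p *s b) = 0}"
    have dom: "snd (fst p) + snd p *s b \<in> ball 0 \<rho>" "fst (fst p) \<in> ball 0 \<rho>"
      if "p \<in> (cball 0 (\<rho>/4) \<times> cball 0 (\<rho>/4)) \<times> sphere 0 r1" for p :: "(complex \<times> (complex^'n)) \<times> complex"
    proof -
      have *: "cmod (fst (fst p)) \<le> \<rho>/4" "norm (snd (fst p)) \<le> \<rho>/4" "cmod (snd p) = r1"
        using that by (auto simp: mem_Times_iff)
      have "norm (snd (fst p) + snd p *s b) \<le> norm (snd (fst p)) + cmod (snd p)"
        using norm_triangle_ineq[of "snd (fst p)" "snd p *s b"] nb by (simp add: norm_smult)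
      then show "snd (fst p) + snd p *s b \<in> ball 0 \<rho>" "fst (fst p) \<in> ball 0 \<rho>"
        using * r1 \<rho> by auto
    qed
    have "continuous_on (ball 0 \<rho> \<times> ball 0 \<rho>) (\<lambda>(s,z). f (s,z))"
      using hol[OF f(1)] by (simp add: holomorphic_pair_def case_prod_beta)
    then have "continuous_on ((cball 0 (\<rho>/4) \<times> cball 0 (\<rho>/4)) \<times> sphere 0 r1) (\<lambda>p. f (fst (fst p), snd (fst p) + snd p *s b))"
      by (rule continuous_on_compose_pair) (use dom in \<open>auto simp only: intro!: continuous_intros\<close>)
    then have "closed C"
      unfolding C_def
      by (intro continuous_closed_preimage_constant closed_Times closed_cball compact_imp_closed[OF compact_sphere])
    moreover have "compact ((cball (0::complex) (\<rho>/4) \<times> cball (0::complex^'n) (\<rho>/4)) \<times> sphere (0::complex) r1)"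
      by (intro compact_Times compact_cball compact_sphere)
    ultimately have "compact (((cball 0 (\<rho>/4) \<times> cball 0 (\<rho>/4)) \<times> sphere 0 r1) \<inter> C)"
      by (intro compact_Int_closed)
    also have "((cball 0 (\<rho>/4) \<times> cball 0 (\<rho>/4)) \<times> sphere 0 r1) \<inter> C = C"
      unfolding C_def by blast
    finally have "compact C" .
    then have "closed (fst ` C)"
      by (intro compact_imp_closed compact_continuous_image continuous_intros)
    moreover have "(0, 0) \<notin> fst ` C"
      using d r1 by (auto simp: C_def)
    ultimately have "open (- fst ` C)" "(0, 0) \<in> - fst ` C" by auto
    then obtain e where e: "e > 0" "ball (0, 0) e \<subseteq> - fst ` C" by (rule openE)
    define \<epsilon>1 where "\<epsilon>1 = min (e/2) (\<rho>/4)"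
    have \<epsilon>1: "0 < \<epsilon>1" "4 * \<epsilon>1 \<le> \<rho>" "2 * \<epsilon>1 \<le> e" using e(1) \<rho> by (auto simp: \<epsilon>1_def)
    have nz: "f (s, z + w *s b) \<noteq> 0" if "s \<in> ball 0 \<epsilon>1" "z \<in> ball 0 \<epsilon>1" "cmod w = r1" for s z w
    proof
      assume "f (s, z + w *s b) = 0"
      then have "((s,z),w) \<in> C" using that \<epsilon>1 by (auto simp: C_def)
      then have "(s,z) \<in> fst ` C" by force
      moreover have "norm (s,z) < e"
        using norm_Pair_le[of s z] that \<epsilon>1 by auto
      ultimately show False using e(2) by (auto simp: dist_norm zero_prod_def[symmetric])
    qed
    define FF' where "FF' = root_resultant r1 f b ` linear_combinations FF"
    have holw: "(\<lambda>w. f (s, z + w *s b)) holomorphic_on ball 0 (2*r1)" if "s \<in> ball 0 \<epsilon>1" "z \<in> ball 0 \<epsilon>1" for s z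
    proof -
      have s: "s \<in> ball 0 \<rho>" using that \<epsilon>1 by auto
      have "(\<lambda>w. f (s, z + w *s b)) holomorphic_on {w. z + w *s b \<in> ball 0 \<rho>}"
        using hol[OF f(1)] s unfolding holomorphic_pair_def by blast
      moreover have "ball 0 (2*r1) \<subseteq> {w. z + w *s b \<in> ball 0 \<rho>}"
      proof
        fix w :: complex assume w: "w \<in> ball 0 (2*r1)"
        have "norm (z + w *s b) \<le> norm z + cmod w"
          using norm_triangle_ineq[of z "w *s b"] nb by (simp add: norm_smult)
        then show "w \<in> {w. z + w *s b \<in> ball 0 \<rho>}" using w that r1 \<epsilon>1 by auto
      qed
      ultimately show ?thesis by (rule holomorphic_on_subset)
    qed
    have vanish: "(\<forall>h\<in>FF'. h (s, z) = 0) \<longleftrightarrow> (\<exists>w\<in>ball 0 r1. \<forall>g\<in>FF. g (s, z + w *s b) = 0)"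
      if "s \<in> ball 0 \<epsilon>1" "z \<in> ball 0 \<epsilon>1" for s z
      using root_resultants_vanish_iff[OF f(1) r1(1) _ holw[OF that] nz[OF that]] r1(1)
      by (simp add: FF'_def)
    have sub: "z + w *s b \<in> coordinate_subspace J" if "z \<in> coordinate_subspace (J - {j})" for z w
      using that j by (auto simp: coordinate_subspace_def b_def axis_def)
    \<comment> \<open>The radius \<open>r/2\<close> leaves room for the lifted coordinate, which is
      smaller than \<open>r1 \<le> r/4\<close>.\<close>
    have "\<exists>\<epsilon>>0. (\<forall>s z. 0 < cmod s \<and> cmod s < \<epsilon> \<and> norm z < \<epsilon> \<and> z \<in> coordinate_subspace (J - {j}) \<longrightarrow> (\<exists>f\<in>FF'. f (s, z) \<noteq> 0)) \<or>
      (\<forall>s. cmod s < \<epsilon> \<longrightarrow> (\<exists>z\<in>coordinate_subspace (J - {j}). norm z < min (r/2) \<epsilon>1 \<and> (\<forall>f\<in>FF'. f (s, z) = 0)))"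
    proof (rule psubset.IH)
      show "J - {j} \<subset> J" using j by auto
      show "0 < \<epsilon>1" "0 < min (r/2) \<epsilon>1" using \<epsilon>1 r by auto
      show "holomorphic_pair \<epsilon>1 h" if "h \<in> FF'" for h
        using that holomorphic_pair_root_resultant[OF hol[OF f(1)] holomorphic_pair_linear_combinations[OF _ hol] nb r1(1,3) \<epsilon>1(2) nz]
        by (auto simp: FF'_def)
      \<comment> \<open>A common zero of the resultants over \<open>s = 0\<close> lifts to a common
        zero of \<open>FF\<close>, hence to the origin. As \<open>z\<close> has no
        \<open>j\<close>-th component, \<open>w\<close> and then \<open>z\<close> must
        vanish.\<close>
      fix z :: "complex^'n" assume z: "z \<in> coordinate_subspace (J - {j})" "norm z < \<epsilon>1" "\<And>h. h \<in> FF' \<Longrightarrow> h (0, z) = 0"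
      then obtain w where w: "w \<in> ball 0 r1" "\<And>g. g \<in> FF \<Longrightarrow> g (0, z + w *s b) = 0"
        using vanish[of 0 z] \<epsilon>1(1) by auto
      have "norm (z + w *s b) \<le> norm z + cmod w"
        using norm_triangle_ineq[of z "w *s b"] nb by (simp add: norm_smult)
      then have "norm (z + w *s b) < \<rho>" using z(2) w(1) r1 \<epsilon>1 by auto
      then have 0: "z + w *s b = 0" using only[OF sub[OF z(1)]] w(2) by blast
      then have "(z + w *s b) $ j = 0" by simp
      then have "w = 0" using z(1) by (auto simp: coordinate_subspace_def b_def)
      with 0 show "z = 0" by simp
    qed
    then obtain \<epsilon> where \<epsilon>: "\<epsilon> > 0" and alt:
      "(\<forall>s z. 0 < cmod s \<and> cmod s < \<epsilon> \<and> norm z < \<epsilon> \<and> z \<in> coordinate_subspace (J - {j}) \<longrightarrow> (\<exists>f\<in>FF'. f (s, z) \<noteq> 0)) \<or>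
      (\<forall>s. cmod s < \<epsilon> \<longrightarrow> (\<exists>z\<in>coordinate_subspace (J - {j}). norm z < min (r/2) \<epsilon>1 \<and> (\<forall>f\<in>FF'. f (s, z) = 0)))"
      by blast
    \<comment> \<open>Splitting off the \<open>j\<close>-th component at most doubles the norm,
      hence the factor 2; the bound by \<open>r1\<close> puts that component into the disc of
      roots.\<close>
    define \<epsilon>2 where "\<epsilon>2 = min (min \<epsilon> \<epsilon>1) r1 / 2"
    have \<epsilon>2: "0 < \<epsilon>2" "2 * \<epsilon>2 \<le> \<epsilon>" "2 * \<epsilon>2 \<le> \<epsilon>1" "2 * \<epsilon>2 \<le> r1"
      using \<epsilon> \<epsilon>1 r1 by (auto simp: \<epsilon>2_def)
    from alt show ?thesis
    proof
      \<comment> \<open>A common zero of \<open>FF\<close> would project to a common zero of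
        \<open>FF'\<close>.\<close>
      assume A: "\<forall>s z. 0 < cmod s \<and> cmod s < \<epsilon> \<and> norm z < \<epsilon> \<and> z \<in> coordinate_subspace (J - {j}) \<longrightarrow> (\<exists>f\<in>FF'. f (s, z) \<noteq> 0)"
      have "\<exists>f\<in>FF. f (s, z) \<noteq> 0" if sz: "0 < cmod s" "cmod s < \<epsilon>2" "norm z < \<epsilon>2" "z \<in> coordinate_subspace J" for s z
      proof (rule ccontr)
        assume neg: "\<not> ?thesis"
        define w where "w = z $ j"
        define z' where "z' = z - w *s b"
        have w: "cmod w \<le> norm z" unfolding w_def by (rule Finite_Cartesian_Product.norm_nth_le)
        have "norm z' \<le> norm z + cmod w"
          unfolding z'_def using norm_triangle_ineq4[of z "w *s b"] nb by (simp add: norm_smult)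
        then have z': "norm z' < \<epsilon>" "norm z' < \<epsilon>1" "z' \<in> coordinate_subspace (J - {j})"
          using w sz \<epsilon>2 by (auto simp: coordinate_subspace_def z'_def b_def w_def axis_def)
        then obtain h where "h \<in> FF'" "h (s, z') \<noteq> 0"
          using A[rule_format, of s z'] sz \<epsilon>2 by auto
        then have "\<not> (\<exists>w\<in>ball 0 r1. \<forall>g\<in>FF. g (s, z' + w *s b) = 0)"
          using vanish[of s z'] z' sz \<epsilon>2 by auto
        moreover have "w \<in> ball 0 r1" using w sz \<epsilon>2 by auto
        moreover have "z' + w *s b = z" by (simp add: z'_def)
        ultimately show False using neg by metis
      qed
      then show ?thesis using \<epsilon>2(1) by blast
    next
      assume A: "\<forall>s. cmod s < \<epsilon> \<longrightarrow> (\<exists>z\<in>coordinate_subspace (J - {j}). norm z < min (r/2) \<epsilon>1 \<and> (\<forall>f\<in>FF'. f (s, z) = 0))"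
      have "\<exists>z\<in>coordinate_subspace J. norm z < r \<and> (\<forall>f\<in>FF. f (s, z) = 0)" if s: "cmod s < \<epsilon>2" for s
      proof -
        have "cmod s < \<epsilon>" using s \<epsilon>2 by linarith
        then obtain z where z: "z \<in> coordinate_subspace (J - {j})" "norm z < r/2" "norm z < \<epsilon>1" "\<forall>f\<in>FF'. f (s, z) = 0"
          using A by auto
        then obtain w where w: "w \<in> ball 0 r1" "\<forall>g\<in>FF. g (s, z + w *s b) = 0"
          using vanish[of s z] s \<epsilon>2 by auto
        have "norm (z + w *s b) \<le> norm z + cmod w"
          using norm_triangle_ineq[of z "w *s b"] nb by (simp add: norm_smult)
        then have "norm (z + w *s b) < r" using z w r1 by auto
        then show ?thesis using w sub[OF z(1)] by blast
      qed
      then show ?thesis using \<epsilon>2(1) by blast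
    qed
  qed
qed

subsection \<open>Condensation points of analytic sets\<close>

lemma holomorphic_several_subset:
  "holomorphic_several f U \<Longrightarrow> W \<subseteq> U \<Longrightarrow> holomorphic_several f W"
  by (auto simp: holomorphic_several_def)

lemma holomorphic_several_continuous_on:
  "holomorphic_several f U \<Longrightarrow> continuous_on U f"
  by (rule continuous_at_imp_continuous_on)
     (auto simp: holomorphic_several_def dest: has_derivative_continuous)

lemma has_derivative_line:
  fixes a b :: "complex^'n"
  shows "((\<lambda>\<zeta>. a + \<zeta> *s b) has_derivative (\<lambda>h. h *s b)) (at \<zeta>)"
proof -
  have "linear (\<lambda>h. h *s b)"
    by (rule linearI) (simp_all add: vec_eq_iff algebra_simps)
  then have "bounded_linear (\<lambda>h. h *s b)" by (simp add: linear_conv_bounded_linear)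
  then show ?thesis
    using has_derivative_add[OF has_derivative_const bounded_linear_imp_has_derivative] by fastforce
qed

lemma holomorphic_several_line:
  assumes "holomorphic_several f U"
  shows "(\<lambda>\<zeta>. f (a + \<zeta> *s b)) holomorphic_on {\<zeta>. a + \<zeta> *s b \<in> U}"
proof (rule holomorphic_onI)
  fix \<zeta> assume "\<zeta> \<in> {\<zeta>. a + \<zeta> *s b \<in> U}"
  then obtain f' where f': "(f has_derivative f') (at (a + \<zeta> *s b))" "\<And>c v. f' (c *s v) = c * f' v"
    using assms unfolding holomorphic_several_def by auto
  have "((\<lambda>\<zeta>. f (a + \<zeta> *s b)) has_derivative (\<lambda>h. f' (h *s b))) (at \<zeta>)"
    using has_derivative_compose[OF has_derivative_line f'(1)] .
  also have "(\<lambda>h. f' (h *s b)) = (*) (f' b)" by (simp add: f'(2) fun_eq_iff)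
  finally have "((\<lambda>\<zeta>. f (a + \<zeta> *s b)) has_field_derivative f' b) (at \<zeta>)"
    by (simp add: has_field_derivative_def)
  then show "(\<lambda>\<zeta>. f (a + \<zeta> *s b)) field_differentiable at \<zeta> within {\<zeta>. a + \<zeta> *s b \<in> U}"
    using field_differentiable_at_within field_differentiable_def by blast
qed

lemma holomorphic_pair_translate:
  assumes "holomorphic_several f (ball q \<rho>)"
  shows "holomorphic_pair \<rho> (\<lambda>(s, z). f (q + z))"
proof -
  have "continuous_on (ball 0 \<rho> \<times> ball 0 \<rho>) (\<lambda>p. f (q + snd p))"
    by (rule continuous_on_compose2[OF holomorphic_several_continuous_on[OF assms]])
       (auto intro!: continuous_intros simp: dist_norm)
  moreover have "(\<lambda>\<zeta>. f (q + (a + \<zeta> *s b))) holomorphic_on {\<zeta>. a + \<zeta> *s b \<in> ball 0 \<rho>}" for a b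
    using holomorphic_several_line[OF assms, of "q + a" b] by (simp add: dist_norm add_ac)
  ultimately show ?thesis
    by (auto simp: holomorphic_pair_def case_prod_beta simp del: mem_ball_0)
qed

lemma holomorphic_pair_graph:
  assumes "holomorphic_several g (ball q \<rho>)"
  shows "holomorphic_pair \<rho> (\<lambda>(s, z). s - g (q + z))"
  using holomorphic_pair_translate[OF assms]
  by (auto simp: holomorphic_pair_def case_prod_beta intro!: continuous_intros holomorphic_intros)

text \<open>Applied to the graph \<open>s = g z\<close>, elimination shows that \<open>g\<close> is open at a point isolated in its fibre.\<close>

lemma ball_subset_image_zero_set:
  fixes F :: "(complex^'n \<Rightarrow> complex) set"
  assumes r: "r > 0" and F: "\<And>f. f \<in> F \<Longrightarrow> holomorphic_several f (ball q r)"
    and g: "holomorphic_several g (ball q r)" "g q = 0"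
    and Z: "Z = {z \<in> ball q r. \<forall>f\<in>F. f z = 0}"
    and iso: "\<And>z. z \<in> Z \<Longrightarrow> g z = 0 \<Longrightarrow> z = q" and lim: "q islimpt Z"
  shows "\<exists>\<epsilon>>0. ball 0 \<epsilon> \<subseteq> g ` Z"
proof -
  \<comment> \<open>The common zeros of \<open>FF\<close> are the graph of \<open>g\<close> over
    \<open>Z\<close>, with \<open>q\<close> moved to the origin.\<close>
  define FF where "FF = insert (\<lambda>(s, z). s - g (q + z)) ((\<lambda>f (s, z). f (q + z)) ` F)"
  have FF0: "(\<forall>f\<in>FF. f (s, z) = 0) \<longleftrightarrow> q + z \<in> Z \<and> s = g (q + z)" if "norm z < r" for s z
    using that by (auto simp: FF_def Z dist_norm)
  have UN: "coordinate_subspace UNIV = (UNIV :: (complex^'n) set)" by (auto simp: coordinate_subspace_def)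
  have "\<exists>\<epsilon>>0. (\<forall>s z. 0 < cmod s \<and> cmod s < \<epsilon> \<and> norm z < \<epsilon> \<and> z \<in> coordinate_subspace UNIV \<longrightarrow> (\<exists>f\<in>FF. f (s, z) \<noteq> 0)) \<or>
    (\<forall>s. cmod s < \<epsilon> \<longrightarrow> (\<exists>z\<in>coordinate_subspace UNIV. norm z < r \<and> (\<forall>f\<in>FF. f (s, z) = 0)))"
  proof (rule elimination[OF r _ _ r])
    show "holomorphic_pair r f" if "f \<in> FF" for f
      using that holomorphic_pair_graph[OF g(1)] holomorphic_pair_translate[OF F] by (auto simp: FF_def)
    fix z :: "complex^'n" assume z: "norm z < r" "\<And>f. f \<in> FF \<Longrightarrow> f (0, z) = 0"
    then have "q + z \<in> Z \<and> 0 = g (q + z)" using FF0[OF z(1), of 0] by blast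
    then show "z = 0" using iso by force
  qed
  then obtain \<epsilon> where \<epsilon>: "\<epsilon> > 0" and alt: "(\<forall>s z. 0 < cmod s \<and> cmod s < \<epsilon> \<and> norm z < \<epsilon> \<longrightarrow> (\<exists>f\<in>FF. f (s, z) \<noteq> 0)) \<or>
    (\<forall>s. cmod s < \<epsilon> \<longrightarrow> (\<exists>z. norm z < r \<and> (\<forall>f\<in>FF. f (s, z) = 0)))"
    unfolding UN by auto
  from alt show ?thesis
  proof
    \<comment> \<open>Impossible: \<open>Z\<close> accumulates at \<open>q\<close>, where
      \<open>g\<close> takes small nonzero values, and each of them yields a common zero of
      \<open>FF\<close>.\<close>
    assume A: "\<forall>s z. 0 < cmod s \<and> cmod s < \<epsilon> \<and> norm z < \<epsilon> \<longrightarrow> (\<exists>f\<in>FF. f (s, z) \<noteq> 0)"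
    have "isCont g q"
      using holomorphic_several_continuous_on[OF g(1)] r by (simp add: continuous_on_eq_continuous_at)
    then obtain d where d: "d > 0" "\<And>z. dist z q < d \<Longrightarrow> cmod (g z) < \<epsilon>"
      using \<epsilon> g(2) unfolding continuous_at_eps_delta by (metis dist_norm diff_zero)
    obtain z where z: "z \<in> Z" "z \<noteq> q" "dist z q < min d \<epsilon>"
      using lim \<epsilon> d(1) unfolding islimpt_approachable by (metis min_less_iff_conj)
    have "g z \<noteq> 0" using iso z by blast
    moreover have "norm (z - q) < r" using z(1) by (auto simp: Z dist_norm norm_minus_commute)
    ultimately show ?thesis
      using A[rule_format, of "g z" "z - q"] FF0[of "z - q" "g z"] z d(2)[of z]
      by (auto simp: dist_norm)
  next
    assume A: "\<forall>s. cmod s < \<epsilon> \<longrightarrow> (\<exists>z. norm z < r \<and> (\<forall>f\<in>FF. f (s, z) = 0))"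
    have "s \<in> g ` Z" if "cmod s < \<epsilon>" for s
      using A[rule_format, OF that] FF0[of _ s] by blast
    then show ?thesis using \<epsilon> by auto
  qed
qed

section \<open>Uncountability at limit points\<close>

lemma holomorphic_several_linear:
  "holomorphic_several (\<lambda>z. \<Sum>i\<in>UNIV. c $ i * (z $ i - q $ i)) (U :: (complex^'n) set)"
  unfolding holomorphic_several_def
proof (intro ballI exI conjI allI)
  fix x :: "complex^'n"
  show "((\<lambda>z. \<Sum>i\<in>UNIV. c $ i * (z $ i - q $ i)) has_derivative (\<lambda>v. \<Sum>i\<in>UNIV. c $ i * v $ i)) (at x)"
    by (auto intro!: derivative_eq_intros bounded_linear_imp_has_derivative bounded_linear_vec_nth)
  show "(\<Sum>i\<in>UNIV. c $ i * (k *s v) $ i) = k * (\<Sum>i\<in>UNIV. c $ i * v $ i)" for k and v :: "complex^'n"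
    by (simp add: sum_distrib_left mult_ac)
qed

text \<open>For each \<open>v\<close> the functionals vanishing at \<open>v\<close> form a null set,
  and countably many null sets do not cover the space.\<close>

lemma exists_nonvanishing_functional:
  fixes P :: "(complex^'n) set"
  assumes "countable P" "0 \<notin> P"
  shows "\<exists>c :: complex^'n. \<forall>v\<in>P. (\<Sum>i\<in>UNIV. c $ i * v $ i) \<noteq> 0"
proof (rule ccontr)
  assume neg: "\<not> ?thesis"
  \<comment> \<open>Only the real part of the value at \<open>v\<close> is required to vanish: this
    gives a real hyperplane, which is negligible and contains the complex one.\<close>
  define H where "H = (\<lambda>v :: complex^'n. {c. (\<chi> i. cnj (v $ i)) \<bullet> c = 0})"
  have "negligible (H v)" if "v \<in> P" for v
    unfolding H_def
  proof (rule negligible_hyperplane)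
    have "v \<noteq> 0" using that assms by auto
    then show "(\<chi> i. cnj (v $ i)) \<noteq> 0 \<or> 0 \<noteq> (0::real)" by (auto simp: vec_eq_iff)
  qed
  then have "negligible (\<Union>(H ` P))"
    using assms(1) by (intro negligible_countable_Union) auto
  moreover have "c \<in> \<Union>(H ` P)" for c
  proof -
    obtain v where v: "v \<in> P" "(\<Sum>i\<in>UNIV. c $ i * v $ i) = 0" using neg by auto
    have "(\<chi> i. cnj (v $ i)) \<bullet> c = Re (\<Sum>i\<in>UNIV. c $ i * v $ i)"
      by (simp add: inner_vec_def inner_complex_def mult.commute)
    then show ?thesis using v by (auto simp: H_def)
  qed
  then have "\<Union>(H ` P) = UNIV" by blast
  ultimately show False
    using open_not_negligible[of "UNIV :: (complex^'n) set"] by simp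
qed

text \<open>If \<open>Z\<close> were countable, some linear functional would vanish on
  \<open>Z\<close> at \<open>q\<close> only. It would then map \<open>Z\<close> onto a set
  containing a disc, which is uncountable.\<close>

lemma uncountable_zero_set:
  fixes F :: "(complex^'n \<Rightarrow> complex) set"
  assumes r: "r > 0" and F: "\<And>f. f \<in> F \<Longrightarrow> holomorphic_several f (ball q r)"
    and Z: "Z = {z \<in> ball q r. \<forall>f\<in>F. f z = 0}" and lim: "q islimpt Z"
  shows "uncountable Z"
proof
  assume "countable Z"
  then have "countable ((\<lambda>z. z - q) ` (Z - {q}))" by blast
  then obtain c :: "complex^'n" where c: "\<forall>v\<in>(\<lambda>z. z - q) ` (Z - {q}). (\<Sum>i\<in>UNIV. c $ i * v $ i) \<noteq> 0"
    using exists_nonvanishing_functional[of "(\<lambda>z. z - q) ` (Z - {q})"] by force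
  define g where "g = (\<lambda>z. \<Sum>i\<in>UNIV. c $ i * (z $ i - q $ i))"
  have "\<exists>\<epsilon>>0. ball 0 \<epsilon> \<subseteq> g ` Z"
  proof (rule ball_subset_image_zero_set[OF r F _ _ Z _ lim])
    show "holomorphic_several g (ball q r)" unfolding g_def by (rule holomorphic_several_linear)
    show "g q = 0" by (simp add: g_def)
    show "z = q" if "z \<in> Z" "g z = 0" for z
      using c that by (auto simp: g_def)
  qed
  then obtain \<epsilon> where "\<epsilon> > 0" "ball 0 \<epsilon> \<subseteq> g ` Z" by blast
  then show False
    using uncountable_ball[of \<epsilon> "0::complex"] \<open>countable Z\<close> by (meson countable_image countable_subset)
qed

section \<open>Condensation points and peak points\<close>

definition condensation_points :: "'a::metric_space set \<Rightarrow> 'a set" where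
  "condensation_points V = {p. \<forall>r>0. uncountable (V \<inter> ball p r)}"

text \<open>By the Lindelof property, countably many open sets with countable trace on
  \<open>V\<close> cover all points that are not condensation points.\<close>

lemma countable_diff_condensation_points:
  fixes V :: "'a::euclidean_space set"
  shows "countable (V - condensation_points V)"
proof -
  define B where "B = {b. open b \<and> countable (V \<inter> b)}"
  obtain B' where B': "B' \<subseteq> B" "countable B'" "\<Union>B' = \<Union>B"
    by (rule Lindelof[of B]) (auto simp: B_def)
  have "V - condensation_points V \<subseteq> \<Union>B"
    unfolding condensation_points_def B_def by force
  then have "V - condensation_points V \<subseteq> (\<Union>b\<in>B'. V \<inter> b)" using B'(3) by blast
  moreover have "countable (\<Union>b\<in>B'. V \<inter> b)"
    using B'(1) by (intro countable_UN[OF B'(2)]) (auto simp: B_def)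
  ultimately show ?thesis by (rule countable_subset)
qed

lemma islimpt_condensation_point:
  assumes "p \<in> condensation_points V"
  shows "p islimpt V"
proof (rule ccontr)
  assume "\<not> ?thesis"
  then obtain e where e: "e > 0" "\<And>x. x \<in> V \<Longrightarrow> x \<noteq> p \<Longrightarrow> \<not> dist x p < e"
    unfolding islimpt_approachable by blast
  have "V \<inter> ball p e \<subseteq> {p}"
  proof
    fix x assume "x \<in> V \<inter> ball p e"
    then show "x \<in> {p}" using e(2)[of x] by (auto simp: dist_commute)
  qed
  then have "countable (V \<inter> ball p e)" by (rule countable_subset) simp
  with assms e show False by (auto simp: condensation_points_def)
qed

lemma closed_condensation_points: "closed (condensation_points V)"
  unfolding closed_def open_contains_ball
proof
  fix p assume "p \<in> - condensation_points V"
  then obtain r where r: "r > 0" "countable (V \<inter> ball p r)" by (auto simp: condensation_points_def)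
  have "x \<in> - condensation_points V" if x: "x \<in> ball p r" for x
  proof -
    obtain e where e: "e > 0" "ball x e \<subseteq> ball p r"
      by (rule openE[OF open_ball x])
    then have "V \<inter> ball x e \<subseteq> V \<inter> ball p r" by blast
    then have "countable (V \<inter> ball x e)" using r(2) by (rule countable_subset)
    then show ?thesis using e by (auto simp: condensation_points_def)
  qed
  then show "\<exists>e>0. ball p e \<subseteq> - condensation_points V" using r by blast
qed

lemma condensation_points_subset:
  assumes "closed V"
  shows "condensation_points V \<subseteq> V"
  using assms islimpt_condensation_point[of _ V] by (auto simp: closed_limpt)

text \<open>At a violating point \<open>q\<close> the function \<open>exp (G z)\<close> would have
  modulus 1 at \<open>q\<close> and smaller modulus at all other nearby points of \<open>A\<close>;
  so \<open>q\<close> would be a local peak point in the sense of function algebras.\<close>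

definition no_peak_points :: "(complex^'n) set \<Rightarrow> bool" where
  "no_peak_points A \<longleftrightarrow> (\<forall>q\<in>A. \<forall>r>0. \<forall>G. holomorphic_several G (ball q r) \<and> G q = 0 \<longrightarrow>
     (\<exists>z\<in>A \<inter> ball q r. z \<noteq> q \<and> 0 \<le> Re (G z)))"

lemma analytic_subvariety_local:
  assumes "analytic_subvariety V" "r > 0"
  obtains r' F where "0 < r'" "r' \<le> r" "\<And>f. f \<in> F \<Longrightarrow> holomorphic_several f (ball q r')"
    "V \<inter> ball q r' = {z \<in> ball q r'. \<forall>f\<in>F. f z = 0}"
proof -
  obtain U F where U: "open U" "q \<in> U" "\<And>f. f \<in> F \<Longrightarrow> holomorphic_several f U"
    "V \<inter> U = {z\<in>U. \<forall>f\<in>F. f z = 0}"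
    using conjunct2[OF assms(1)[unfolded analytic_subvariety_def], rule_format, of q] by blast
  obtain e where e: "e > 0" "ball q e \<subseteq> U" by (rule openE[OF U(1,2)])
  have sub: "ball q (min e r) \<subseteq> U" using e by auto
  show thesis
  proof
    show "0 < min e r" "min e r \<le> r" using e assms by auto
    show "holomorphic_several f (ball q (min e r))" if "f \<in> F" for f
      using holomorphic_several_subset U(3) that sub by blast
    show "V \<inter> ball q (min e r) = {z \<in> ball q (min e r). \<forall>f\<in>F. f z = 0}"
      using U(4) sub by blast
  qed
qed

lemma islimpt_Int_ball:
  assumes "q islimpt V" "r > 0"
  shows "q islimpt (V \<inter> ball q r)"
  unfolding islimpt_approachable
proof (intro allI impI)
  fix e :: real assume "e > 0"
  then have "min e r > 0" using assms(2) by simp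
  then obtain x where "x \<in> V" "x \<noteq> q" "dist x q < min e r"
    using assms(1) unfolding islimpt_approachable by blast
  then show "\<exists>x'\<in>V \<inter> ball q r. x' \<noteq> q \<and> dist x' q < e"
    by (intro bexI[of _ x]) (auto simp: dist_commute)
qed

lemma limpt_imp_condensation_point:
  assumes "analytic_subvariety V" "p islimpt V"
  shows "p \<in> condensation_points V"
  unfolding condensation_points_def
proof (intro CollectI allI impI)
  fix r :: real assume "r > 0"
  then obtain r' F where r': "0 < r'" "r' \<le> r" "\<And>f. f \<in> F \<Longrightarrow> holomorphic_several f (ball p r')"
    "V \<inter> ball p r' = {z \<in> ball p r'. \<forall>f\<in>F. f z = 0}"
    by (rule analytic_subvariety_local[OF assms(1), where q = p]) blast
  have "uncountable (V \<inter> ball p r')"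
    by (rule uncountable_zero_set[OF r'(1,3,4) islimpt_Int_ball[OF assms(2) r'(1)]])
  moreover have "V \<inter> ball p r' \<subseteq> V \<inter> ball p r" using r' by auto
  ultimately show "uncountable (V \<inter> ball p r)" using countable_subset by blast
qed

text \<open>At a peak, \<open>G\<close> has few zeros on \<open>V\<close> near \<open>q\<close>, so
  it is open there and takes all small positive values. These can only come from the countable set
  of points of \<open>V\<close> that are not condensation points, a contradiction.\<close>

lemma no_peak_points_condensation_points:
  fixes V :: "(complex^'n) set"
  assumes V: "analytic_subvariety V"
  shows "no_peak_points (condensation_points V)"
  unfolding no_peak_points_def
proof (intro ballI allI impI, elim conjE)
  fix q :: "complex^'n" and r :: real and G
  assume q: "q \<in> condensation_points V" and "r > 0" and G: "holomorphic_several G (ball q r)" "G q = 0"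
  show "\<exists>z\<in>condensation_points V \<inter> ball q r. z \<noteq> q \<and> 0 \<le> Re (G z)"
  proof (rule ccontr)
    assume neg: "\<not> ?thesis"
    obtain r' F where r': "0 < r'" "r' \<le> r" "\<And>f. f \<in> F \<Longrightarrow> holomorphic_several f (ball q r')"
      "V \<inter> ball q r' = {z \<in> ball q r'. \<forall>f\<in>F. f z = 0}"
      by (rule analytic_subvariety_local[OF V \<open>r > 0\<close>, where q = q]) blast
    have sub: "ball q r' \<subseteq> ball q r" using r' by auto
    \<comment> \<open>Apart from \<open>q\<close>, a zero of \<open>G\<close> on \<open>V\<close>
      cannot be a condensation point, so \<open>Z1\<close> is countable and \<open>q\<close> is
      isolated in it.\<close>
    define Z1 where "Z1 = {z \<in> ball q r'. \<forall>f\<in>insert G F. f z = 0}"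
    have "Z1 \<subseteq> insert q (V - condensation_points V)"
    proof
      fix z assume z: "z \<in> Z1"
      then have "z \<in> V" "z \<in> ball q r" "G z = 0" using r'(4) sub by (auto simp: Z1_def)
      then show "z \<in> insert q (V - condensation_points V)" using neg by force
    qed
    then have "countable Z1"
      using countable_diff_condensation_points[of V] countable_subset by (metis countable_insert)
    moreover have "uncountable Z1" if "q islimpt Z1"
      by (rule uncountable_zero_set[OF r'(1) _ Z1_def that])
         (use r'(3) holomorphic_several_subset[OF G(1) sub] in auto)
    ultimately have "\<not> q islimpt Z1" by blast
    then obtain e where e: "e > 0" "\<And>x. x \<in> Z1 \<Longrightarrow> x \<noteq> q \<Longrightarrow> \<not> dist x q < e"
      unfolding islimpt_approachable by blast
    define s where "s = min e r'"
    have s: "s > 0" "ball q s \<subseteq> ball q r'" "ball q s \<subseteq> ball q e" using e r' by (auto simp: s_def)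
    have Vs: "V \<inter> ball q s = {z \<in> ball q s. \<forall>f\<in>F. f z = 0}" using r'(4) s by blast
    have "\<exists>\<epsilon>>0. ball 0 \<epsilon> \<subseteq> G ` (V \<inter> ball q s)"
    proof (rule ball_subset_image_zero_set[where g = G and q = q, OF s(1) _ _ G(2) Vs])
      show "holomorphic_several f (ball q s)" if "f \<in> F" for f
        using holomorphic_several_subset r'(3) that s by blast
      show "holomorphic_several G (ball q s)"
        using holomorphic_several_subset G(1) s sub by blast
      show "z = q" if "z \<in> V \<inter> ball q s" "G z = 0" for z
      proof (rule ccontr)
        assume "z \<noteq> q"
        moreover have "z \<in> Z1" using that s(2) Vs unfolding Z1_def by blast
        ultimately have "\<not> dist z q < e" using e by blast
        then show False using that s(3) by (auto simp: dist_commute)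
      qed
      show "q islimpt V \<inter> ball q s"
        by (rule islimpt_Int_ball[OF islimpt_condensation_point[OF q] s(1)])
    qed
    then obtain \<epsilon> where \<epsilon>: "\<epsilon> > 0" "ball 0 \<epsilon> \<subseteq> G ` (V \<inter> ball q s)" by blast
    \<comment> \<open>Where \<open>G\<close> takes a positive real value, the peak assumption
      excludes condensation points.\<close>
    have "of_real ` {0<..<\<epsilon>} \<subseteq> G ` (V - condensation_points V)"
    proof
      fix w assume "w \<in> complex_of_real ` {0<..<\<epsilon>}"
      then obtain x where x: "w = of_real x" "0 < x" "x < \<epsilon>" by auto
      then have "w \<in> ball 0 \<epsilon>" by simp
      then obtain z where z: "z \<in> V \<inter> ball q s" "w = G z" using \<epsilon> by blast
      then have "Re (G z) = x" using x by (metis Re_complex_of_real)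
      then have "z \<noteq> q" "0 \<le> Re (G z)" using G(2) x by auto
      moreover have "z \<in> ball q r" using z(1) s(2) sub by blast
      ultimately have "z \<notin> condensation_points V" using bexI[of _ z] neg by auto
      then show "w \<in> G ` (V - condensation_points V)" using z by blast
    qed
    then have "countable (complex_of_real ` {0<..<\<epsilon>})"
      using countable_diff_condensation_points[of V] by (meson countable_image countable_subset)
    then have "countable {0<..<\<epsilon>}"
      by (rule countable_image_inj_on) (auto simp: inj_on_def)
    then show False using \<epsilon>(1) uncountable_open_interval[of 0 \<epsilon>] by simp
  qed
qed

subsection \<open>Capturing sets without peak points\<close>

lemma holomorphic_several_add:
  "holomorphic_several f U \<Longrightarrow> holomorphic_several g U \<Longrightarrow> holomorphic_several (\<lambda>z. f z + g z) U"
  unfolding holomorphic_several_def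
proof (intro ballI)
  fix x assume f: "\<forall>x\<in>U. \<exists>f'. (f has_derivative f') (at x) \<and> (\<forall>c v. f' (c *s v) = c * f' v)"
    and g: "\<forall>x\<in>U. \<exists>f'. (g has_derivative f') (at x) \<and> (\<forall>c v. f' (c *s v) = c * f' v)" and x: "x \<in> U"
  obtain f' where f': "(f has_derivative f') (at x)" "\<And>c v. f' (c *s v) = c * f' v" using f x by auto
  obtain g' where g': "(g has_derivative g') (at x)" "\<And>c v. g' (c *s v) = c * g' v" using g x by auto
  show "\<exists>h'. ((\<lambda>z. f z + g z) has_derivative h') (at x) \<and> (\<forall>c v. h' (c *s v) = c * h' v)"
    by (rule exI[of _ "\<lambda>v. f' v + g' v"]) (auto intro!: has_derivative_add f' g' simp: f'(2) g'(2) algebra_simps)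
qed

lemma holomorphic_several_const: "holomorphic_several (\<lambda>z. k) U"
  unfolding holomorphic_several_def by (auto intro!: exI[of _ "\<lambda>_. 0"])

lemma holomorphic_several_compose_coordinate:
  fixes U :: "(complex^'n) set"
  assumes "k holomorphic_on S" "open S" "\<And>z. z \<in> U \<Longrightarrow> z $ j \<in> S"
  shows "holomorphic_several (\<lambda>z. k (z $ j)) U"
  unfolding holomorphic_several_def
proof
  fix x :: "complex^'n" assume "x \<in> U"
  then have "(k has_field_derivative deriv k (x $ j)) (at (x $ j))"
    using assms holomorphic_derivI by blast
  then have "(k has_derivative (*) (deriv k (x $ j))) (at (x $ j))"
    by (simp add: has_field_derivative_def)
  then have "((\<lambda>z. k (z $ j)) has_derivative (\<lambda>v. deriv k (x $ j) * v $ j)) (at x)"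
    using has_derivative_compose[OF bounded_linear_imp_has_derivative[OF bounded_linear_vec_nth]] by blast
  then show "\<exists>f'. ((\<lambda>z. k (z $ j)) has_derivative f') (at x) \<and> (\<forall>c v. f' (c *s v) = c * f' v)"
    by (rule exI[of _ "\<lambda>v. deriv k (x $ j) * v $ j", OF conjI]) (simp add: mult_ac)
qed

text \<open>Splits the squared norm at \<open>q\<close> into the real part of a holomorphic function
  and a remainder that is positive away from \<open>q\<close>.\<close>

lemma norm_square_expand:
  fixes z q :: "complex^'n"
  shows "(norm z)\<^sup>2 = (norm q)\<^sup>2 + 2 * Re (\<Sum>i\<in>UNIV. cnj (q $ i) * (z $ i - q $ i)) + (norm (z - q))\<^sup>2"
proof -
  have "(norm z)\<^sup>2 = (norm (q + (z - q)))\<^sup>2" by simp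
  also have "\<dots> = (norm q)\<^sup>2 + 2 * (q \<bullet> (z - q)) + (norm (z - q))\<^sup>2"
    by (simp only: power2_norm_eq_inner) (simp add: inner_simps inner_commute)
  also have "q \<bullet> (z - q) = Re (\<Sum>i\<in>UNIV. cnj (q $ i) * (z $ i - q $ i))"
    by (simp add: inner_vec_def inner_complex_def)
  finally show ?thesis .
qed

text \<open>Near \<open>q\<close> the function differs from a constant by \<open>Re G\<close> plus
  \<open>\<delta> * (norm (z - q))\<^sup>2\<close> with \<open>G\<close> holomorphic. A local
  maximum at \<open>q\<close> would thus force \<open>Re G < 0\<close> at all other nearby points of
  \<open>A\<close>.\<close>

lemma no_peak_points_strict_max:
  fixes A :: "(complex^'n) set"
  assumes "no_peak_points A" "q \<in> A" "e > 0" "\<delta> > 0" "holomorphic_several h (ball q e)"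
    and max: "\<And>z. z \<in> A \<Longrightarrow> z \<in> ball q e \<Longrightarrow> Re (h z) + \<delta> * (norm z)\<^sup>2 \<le> Re (h q) + \<delta> * (norm q)\<^sup>2"
  shows False
proof -
  define c :: "complex^'n" where "c = (\<chi> i. of_real (2 * \<delta>) * cnj (q $ i))"
  define G where "G = (\<lambda>z. (h z + - h q) + (\<Sum>i\<in>UNIV. c $ i * (z $ i - q $ i)))"
  have "holomorphic_several G (ball q e)"
    unfolding G_def by (intro holomorphic_several_add assms(5) holomorphic_several_const holomorphic_several_linear)
  moreover have "G q = 0" by (simp add: G_def)
  ultimately obtain z where z: "z \<in> A" "z \<in> ball q e" "z \<noteq> q" "0 \<le> Re (G z)"
    using assms(1-3) unfolding no_peak_points_def by blast
  have "(\<Sum>i\<in>UNIV. c $ i * (z $ i - q $ i)) = of_real (2 * \<delta>) * (\<Sum>i\<in>UNIV. cnj (q $ i) * (z $ i - q $ i))"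
    unfolding sum_distrib_left by (intro sum.cong refl) (simp add: c_def)
  then have "Re (G z) = Re (h z) - Re (h q) + 2 * \<delta> * Re (\<Sum>i\<in>UNIV. cnj (q $ i) * (z $ i - q $ i))"
    by (simp add: G_def del: Re_sum)
  also have "\<dots> = Re (h z) - Re (h q) + \<delta> * ((norm z)\<^sup>2 - (norm q)\<^sup>2 - (norm (z - q))\<^sup>2)"
    using norm_square_expand[of z q] by (simp add: algebra_simps)
  also have "\<dots> = (Re (h z) + \<delta> * (norm z)\<^sup>2) - (Re (h q) + \<delta> * (norm q)\<^sup>2) - \<delta> * (norm (z - q))\<^sup>2"
    by (simp add: algebra_simps)
  also have "\<dots> \<le> - \<delta> * (norm (z - q))\<^sup>2" using max[OF z(1,2)] by simp
  also have "\<dots> < 0" using \<open>\<delta> > 0\<close> z(3) by simp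
  finally show False using z(4) by simp
qed

text \<open>If \<open>A\<close> avoided the lateral boundary \<open>\<psi> = r\<close> and the slice \<open>z $ j = t\<close>, then
  \<open>- ln \<bar>z $ j - t\<bar> + \<delta> \<bar>z\<bar>\<^sup>2\<close> would have an interior maximum on \<open>A\<close>.\<close>

lemma box_capture:
  fixes A O' B :: "(complex^'n) set" and \<psi> :: "complex^'n \<Rightarrow> real"
  assumes A: "closedin (top_of_set O') A" "no_peak_points A"
    and B: "compact B" "B \<subseteq> O'" "B = {z. cmod (z $ j - t) \<le> \<rho> \<and> \<psi> z \<le> r}"
    and \<psi>: "continuous_on UNIV \<psi>"
    and p: "p \<in> A" "cmod (p $ j - t) < \<rho>" "\<psi> p < r"
  shows "A \<inter> ({z. cmod (z $ j - t) \<le> \<rho> \<and> \<psi> z = r} \<union> {z. z $ j = t \<and> \<psi> z \<le> r}) \<noteq> {}"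
proof
  assume empty: "A \<inter> ({z. cmod (z $ j - t) \<le> \<rho> \<and> \<psi> z = r} \<union> {z. z $ j = t \<and> \<psi> z \<le> r}) = {}"
  obtain C where C: "closed C" "A = O' \<inter> C" using A(1) unfolding closedin_closed by blast
  then have "A \<inter> B = B \<inter> C" using B by auto
  then have cAB: "compact (A \<inter> B)" using C B compact_Int_closed by auto
  have pB: "p \<in> A \<inter> B" using p B by auto
  have nt: "z $ j \<noteq> t" if "z \<in> A \<inter> B" for z using that empty B(3) by auto
  have "bounded B" using B(1) compact_imp_bounded by blast
  then obtain R where R: "\<And>z. z \<in> B \<Longrightarrow> norm z \<le> R" by (auto simp: bounded_iff)
  define \<delta> where "\<delta> = (ln \<rho> - ln (cmod (p $ j - t))) / (R\<^sup>2 + 1)"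
  have pt: "cmod (p $ j - t) > 0" using nt[OF pB] by simp
  have R1: "R\<^sup>2 + 1 > 0" by (simp add: add_nonneg_pos)
  have "ln (cmod (p $ j - t)) < ln \<rho>" using pt p(2) by (intro ln_less_cancel_iff[THEN iffD2]) linarith+
  then have \<delta>: "\<delta> > 0" unfolding \<delta>_def using R1 by (intro divide_pos_pos) auto
  define u where "u = (\<lambda>z::complex^'n. - ln (cmod (z $ j - t)) + \<delta> * (norm z)\<^sup>2)"
  have "continuous_on (A \<inter> B) u"
    unfolding u_def by (intro continuous_intros) (use nt in auto)
  then obtain q where q: "q \<in> A \<inter> B" "\<And>z. z \<in> A \<inter> B \<Longrightarrow> u z \<le> u q"
    using continuous_attains_sup[OF cAB] pB by blast
  have "\<delta> * (norm q)\<^sup>2 \<le> \<delta> * R\<^sup>2"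
    using R q(1) \<delta> by (intro mult_left_mono power_mono) auto
  also have "\<dots> < \<delta> * (R\<^sup>2 + 1)" using \<delta> by simp
  also have "\<dots> = ln \<rho> - ln (cmod (p $ j - t))" using R1 by (simp add: \<delta>_def)
  finally have *: "\<delta> * (norm q)\<^sup>2 < ln \<rho> - ln (cmod (p $ j - t))" .
  have "- ln (cmod (p $ j - t)) \<le> u p" using \<delta> by (simp add: u_def)
  also have "\<dots> \<le> u q" using q pB by blast
  finally have "ln (cmod (q $ j - t)) < ln \<rho>" using * by (simp add: u_def)
  moreover have qt: "cmod (q $ j - t) > 0" using nt[OF q(1)] by simp
  moreover have "\<rho> > 0" using p(2) pt by linarith
  ultimately have q1: "cmod (q $ j - t) < \<rho>" by (simp add: ln_less_cancel_iff)
  have q2: "\<psi> q < r" using q(1) empty B(3) by force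
  have "open {z::complex^'n. cmod (z $ j - t) < \<rho>}" "open {z. \<psi> z < r}"
    by (intro open_Collect_less continuous_intros \<psi>)+
  then have "open ({z. cmod (z $ j - t) < \<rho>} \<inter> {z. \<psi> z < r})" by (rule open_Int)
  moreover have "q \<in> {z. cmod (z $ j - t) < \<rho>} \<inter> {z. \<psi> z < r}" using q1 q2 by simp
  ultimately obtain e1 where e1: "e1 > 0" "ball q e1 \<subseteq> {z. cmod (z $ j - t) < \<rho>} \<inter> {z. \<psi> z < r}"
    by (rule openE)
  define e where "e = min e1 (cmod (q $ j - t))"
  have e: "e > 0" using e1 qt by (simp add: e_def)
  \<comment> \<open>A local branch of the logarithm: dividing by \<open>q $ j - t\<close> centres
    the argument at 1, and in the ball of radius \<open>e\<close> it stays in the right half-plane.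
    The real part changes only by a constant.\<close>
  define h where "h = (\<lambda>z::complex^'n. - Ln ((z $ j - t) / (q $ j - t)))"
  have half: "(w - t) / (q $ j - t) \<notin> \<real>\<^sub>\<le>\<^sub>0" if "w \<in> ball (q $ j) (cmod (q $ j - t))" for w
  proof -
    have "(w - t) / (q $ j - t) = 1 + (w - q $ j) / (q $ j - t)"
      using qt by (simp add: field_simps)
    moreover have "cmod ((w - q $ j) / (q $ j - t)) < 1"
      using that qt by (simp add: norm_divide dist_norm norm_minus_commute)
    ultimately have "Re ((w - t) / (q $ j - t)) > 0"
      using complex_Re_le_cmod[of "- ((w - q $ j) / (q $ j - t))"] by simp
    then show ?thesis by (auto simp: complex_nonpos_Reals_iff)
  qed
  have near: "z $ j \<in> ball (q $ j) (cmod (q $ j - t))" if "z \<in> ball q e" for z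
    using that Finite_Cartesian_Product.norm_nth_le[of "q - z" j] by (auto simp: e_def dist_norm)
  show False
  proof (rule no_peak_points_strict_max[OF A(2) _ e \<delta>])
    show "q \<in> A" using q by simp
    have "(\<lambda>w. - Ln ((w - t) / (q $ j - t))) holomorphic_on ball (q $ j) (cmod (q $ j - t))"
      using half qt by (intro holomorphic_intros) auto
    then show "holomorphic_several h (ball q e)"
      unfolding h_def by (rule holomorphic_several_compose_coordinate) (use near in auto)
    fix z assume z: "z \<in> A" "z \<in> ball q e"
    then have "z \<in> ball q e1" by (simp add: e_def)
    then have "z \<in> A \<inter> B" using z e1(2) B(3) by auto
    then have le: "u z \<le> u q" and zt: "z $ j \<noteq> t" using q nt by auto
    have "Re (h z) = - ln (cmod (z $ j - t)) + ln (cmod (q $ j - t))"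
      using zt qt by (simp add: h_def norm_divide ln_div)
    moreover have "Re (h q) = 0" using qt by (simp add: h_def)
    ultimately show "Re (h z) + \<delta> * (norm z)\<^sup>2 \<le> Re (h q) + \<delta> * (norm q)\<^sup>2"
      using le by (simp add: u_def)
  qed
qed

text \<open>The test sets are closed relative to \<open>U\<close> only, so they may be cut down to a
  smaller open set and the notion composes along nested sets.\<close>

definition captures :: "(complex^'n) set \<Rightarrow> (complex^'n) set \<Rightarrow> (complex^'n) set \<Rightarrow> bool" where
  "captures U X Y \<longleftrightarrow> (\<forall>A. closedin (top_of_set U) A \<and> no_peak_points A \<and> A \<inter> Y \<noteq> {} \<longrightarrow> A \<inter> X \<noteq> {})"

definition thin_components :: "'n set \<Rightarrow> real \<Rightarrow> (complex^'n) set \<Rightarrow> bool" where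
  "thin_components J \<epsilon> U \<longleftrightarrow>
     (\<forall>C. connected C \<and> C \<subseteq> U \<longrightarrow> (\<forall>x\<in>C. \<forall>y\<in>C. \<forall>j\<in>J. cmod (x $ j - y $ j) \<le> \<epsilon>))"

section \<open>Finite families of thin compact pieces\<close>

lemma separate_compact_family:
  fixes H :: "'i \<Rightarrow> 'a::heine_borel set"
  assumes "finite T" "\<And>t. t \<in> T \<Longrightarrow> compact (H t)" "\<And>s t. s \<in> T \<Longrightarrow> t \<in> T \<Longrightarrow> s \<noteq> t \<Longrightarrow> H s \<inter> H t = {}"
  shows "\<exists>d>0. \<forall>s\<in>T. \<forall>t\<in>T. s \<noteq> t \<longrightarrow> (\<forall>x\<in>H s. \<forall>y\<in>H t. d \<le> dist x y)"
proof -
  define P where "P = {p \<in> T \<times> T. fst p \<noteq> snd p}"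
  have "\<exists>d>0. \<forall>x\<in>H (fst p). \<forall>y\<in>H (snd p). d \<le> dist x y" if "p \<in> P" for p
    using separate_compact_closed[of "H (fst p)" "H (snd p)"] that assms
    by (auto simp: P_def compact_imp_closed)
  then obtain d where d: "\<And>p. p \<in> P \<Longrightarrow> d p > 0"
    "\<And>p x y. p \<in> P \<Longrightarrow> x \<in> H (fst p) \<Longrightarrow> y \<in> H (snd p) \<Longrightarrow> d p \<le> dist x y"
    by metis
  \<comment> \<open>The extra element 1 keeps the minimum meaningful when there are no
    pairs.\<close>
  have fin: "finite (insert 1 (d ` P))" using assms(1) by (simp add: P_def)
  have "Min (insert 1 (d ` P)) > 0" using d(1) fin by (subst Min_gr_iff) auto
  moreover have "Min (insert 1 (d ` P)) \<le> dist x y" if "s \<in> T" "t \<in> T" "s \<noteq> t" "x \<in> H s" "y \<in> H t" for s t x y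
  proof -
    have "(s,t) \<in> P" using that by (simp add: P_def)
    then have "Min (insert 1 (d ` P)) \<le> d (s,t)" using fin by (intro Min_le) auto
    also have "\<dots> \<le> dist x y" using d(2)[OF \<open>(s,t) \<in> P\<close>] that by simp
    finally show ?thesis .
  qed
  ultimately show ?thesis by blast
qed

text \<open>The square lattice of mesh \<open>\<sigma>\<close>: its covering radius \<open>\<sigma> / sqrt 2\<close> is less than \<open>9 \<sigma> / 10\<close>,
  which is less than the distance of two lattice points.\<close>

lemma finite_lattice_net:
  assumes "\<sigma> > 0"
  obtains T :: "complex set" where "finite T"
    "\<And>w. cmod w \<le> R \<Longrightarrow> \<exists>t\<in>T. cmod (w - t) < 9 / 10 * \<sigma>"
    "\<And>s t. s \<in> T \<Longrightarrow> t \<in> T \<Longrightarrow> s \<noteq> t \<Longrightarrow> \<sigma> \<le> cmod (s - t)"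
proof -
  define L where "L = (\<lambda>(a::int, b::int). Complex (\<sigma> * a) (\<sigma> * b))"
  \<comment> \<open>One more than the scaled radius, because rounding can move a coordinate by
    1/2.\<close>
  define M where "M = \<lceil>R / \<sigma>\<rceil> + 1"
  show thesis
  proof
    show "finite (L ` ({-M..M} \<times> {-M..M}))" by simp
    show "\<exists>t\<in>L ` ({-M..M} \<times> {-M..M}). cmod (w - t) < 9 / 10 * \<sigma>" if w: "cmod w \<le> R" for w
    proof -
      define a b where "a = round (Re w / \<sigma>)" and "b = round (Im w / \<sigma>)"
      have bnd: "\<bar>x - \<sigma> * round (x / \<sigma>)\<bar> \<le> \<sigma> / 2" for x
      proof -
        have "\<bar>of_int (round (x / \<sigma>)) - x / \<sigma>\<bar> * \<sigma> \<le> 1 / 2 * \<sigma>"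
          using of_int_round_abs_le[of "x / \<sigma>"] assms by (intro mult_right_mono) auto
        moreover have "\<bar>of_int (round (x / \<sigma>)) - x / \<sigma>\<bar> * \<sigma> = \<bar>x - \<sigma> * round (x / \<sigma>)\<bar>"
        proof -
          have "(of_int (round (x / \<sigma>)) - x / \<sigma>) * \<sigma> = \<sigma> * round (x / \<sigma>) - x" using assms by (simp add: field_simps)
          then show ?thesis using assms by (metis abs_minus_commute abs_mult abs_of_pos)
        qed
        ultimately show ?thesis by simp
      qed
      have mem: "round (x / \<sigma>) \<in> {-M..M}" if "\<bar>x\<bar> \<le> R" for x
      proof -
        have "\<bar>x / \<sigma>\<bar> \<le> R / \<sigma>" using that assms by (simp add: divide_right_mono)
        then have "\<bar>x / \<sigma>\<bar> \<le> of_int \<lceil>R / \<sigma>\<rceil>" using le_of_int_ceiling order_trans by blast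
        moreover have "\<bar>of_int (round (x / \<sigma>)) - x / \<sigma>\<bar> \<le> 1 / 2" by (rule of_int_round_abs_le)
        ultimately have "\<bar>real_of_int (round (x / \<sigma>))\<bar> \<le> of_int M" unfolding M_def of_int_add of_int_1 by linarith
        then show ?thesis by (simp add: abs_le_iff flip: of_int_minus)
      qed
      have "\<bar>Re w\<bar> \<le> R" "\<bar>Im w\<bar> \<le> R"
        using w abs_Re_le_cmod[of w] abs_Im_le_cmod[of w] by linarith+
      then have "L (a, b) \<in> L ` ({-M..M} \<times> {-M..M})"
        using mem[of "Re w"] mem[of "Im w"] by (auto simp: a_def b_def)
      moreover have "cmod (w - L (a, b)) < 9 / 10 * \<sigma>"
      proof -
        have "(cmod (w - L (a, b)))\<^sup>2 = (Re w - \<sigma> * a)\<^sup>2 + (Im w - \<sigma> * b)\<^sup>2"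
          by (simp add: cmod_power2 L_def)
        also have "\<dots> \<le> (\<sigma> / 2)\<^sup>2 + (\<sigma> / 2)\<^sup>2"
          using bnd[of "Re w"] bnd[of "Im w"] assms unfolding a_def b_def
          by (intro add_mono) (simp_all add: abs_le_square_iff[symmetric])
        also have "\<dots> < (9 / 10 * \<sigma>)\<^sup>2" using assms by (simp add: power2_eq_square)
        finally show ?thesis using assms by (rule_tac power_less_imp_less_base) auto
      qed
      ultimately show ?thesis by blast
    qed
    fix s t assume s: "s \<in> L ` ({-M..M} \<times> {-M..M})" and t: "t \<in> L ` ({-M..M} \<times> {-M..M})" and "s \<noteq> t"
    obtain a b where ab: "s = L (a, b)" using s by auto
    obtain c d where cd: "t = L (c, d)" using t by auto
    have *: "\<sigma> \<le> \<bar>\<sigma> * of_int x - \<sigma> * of_int y\<bar>" if "x \<noteq> y" for x y :: int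
    proof -
      have "1 \<le> \<bar>real_of_int (x - y)\<bar>" using that by linarith
      then have "\<sigma> * 1 \<le> \<sigma> * \<bar>real_of_int (x - y)\<bar>" using assms by (intro mult_left_mono) auto
      then show ?thesis using assms by (simp add: abs_mult flip: right_diff_distrib)
    qed
    have "a \<noteq> c \<or> b \<noteq> d" using \<open>s \<noteq> t\<close> ab cd by auto
    then show "\<sigma> \<le> cmod (s - t)"
    proof
      assume "a \<noteq> c"
      then have "\<sigma> \<le> \<bar>Re (s - t)\<bar>" using * by (simp add: ab cd L_def)
      then show ?thesis using abs_Re_le_cmod[of "s - t"] by linarith
    next
      assume "b \<noteq> d"
      then have "\<sigma> \<le> \<bar>Im (s - t)\<bar>" using * by (simp add: ab cd L_def)
      then show ?thesis using abs_Im_le_cmod[of "s - t"] by linarith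
    qed
  qed
qed

text \<open>\<open>X\<close> is the union of the pieces from \<open>box_capture\<close>, one for
  each lattice point. They are disjoint, since the lateral parts lie on different levels of the
  distance to \<open>Y\<close> and no slice through a centre meets the disc of another
  centre.\<close>

lemma capture_step:
  fixes U Y :: "(complex^'n) set"
  assumes U: "open U" and Y: "compact Y" "Y \<subseteq> U" and \<epsilon>: "\<epsilon> > 0"
  obtains X \<eta> where "compact X" "X \<subseteq> U" "\<eta> > 0" "captures U X Y" "thin_components {j} \<epsilon> (\<Union>x\<in>X. ball x \<eta>)"
proof (cases "Y = {}")
  case True
  show thesis
    by (rule that[of "{}" 1]) (auto simp: True captures_def thin_components_def)
next
  case False
  obtain r0 where r0: "r0 > 0" "(\<Union>x\<in>Y. cball x r0) \<subseteq> U"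
    using compact_subset_open_imp_cball_epsilon_subset[OF Y(1) U Y(2)] by blast
  define \<psi> where "\<psi> = (\<lambda>z. infdist z Y)"
  have \<psi>: "continuous_on S \<psi>" for S unfolding \<psi>_def by (intro continuous_intros)
  have sub: "{z. \<psi> z \<le> r0} \<subseteq> (\<Union>x\<in>Y. cball x r0)"
  proof
    fix z assume z: "z \<in> {z. \<psi> z \<le> r0}"
    obtain x where "x \<in> Y" "infdist z Y = dist z x"
      using infdist_attains_inf[OF compact_imp_closed[OF Y(1)] False] by metis
    then show "z \<in> (\<Union>x\<in>Y. cball x r0)" using z by (auto simp: \<psi>_def dist_commute)
  qed
  have closed_le: "closed {z. \<psi> z \<le> r}" "closed {z. \<psi> z = r}" for r
    by (intro closed_Collect_le closed_Collect_eq \<psi> continuous_intros)+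
  have cpt: "compact {z. \<psi> z \<le> r0}"
    using compact_Int_closed[OF compact_minkowski_sum_cball[OF Y(1), of r0] closed_le(1)[of r0]] sub
    by (simp add: inf.absorb2)
  obtain R where R: "\<And>y. y \<in> Y \<Longrightarrow> norm y \<le> R"
    using compact_imp_bounded[OF Y(1)] by (auto simp: bounded_iff)
  \<comment> \<open>A component lies within \<open>\<rho> + \<eta> \<le> 19/10 * \<sigma>\<close> of
    one centre, so its width is at most \<open>38/10 * \<sigma>\<close>, which is less than
    \<open>4 * \<sigma> = \<epsilon>\<close>.\<close>
  define \<sigma> where "\<sigma> = \<epsilon> / 4"
  have \<sigma>: "\<sigma> > 0" using \<epsilon> by (simp add: \<sigma>_def)
  obtain T where T: "finite T" "\<And>w. cmod w \<le> R \<Longrightarrow> \<exists>t\<in>T. cmod (w - t) < 9 / 10 * \<sigma>"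
    "\<And>s t. s \<in> T \<Longrightarrow> t \<in> T \<Longrightarrow> s \<noteq> t \<Longrightarrow> \<sigma> \<le> cmod (s - t)"
    by (rule finite_lattice_net[OF \<sigma>]) blast
  obtain f and n :: nat where f: "f ` T = {i. i < n}" "inj_on f T"
    using finite_imp_inj_to_nat_seg[OF T(1)] by blast
  define \<rho> where "\<rho> = 9 / 10 * \<sigma>"
  \<comment> \<open>The injective numbering \<open>f\<close> of the centres gives them distinct
    levels strictly between 0 and \<open>r0\<close>.\<close>
  define rad where "rad = (\<lambda>t. r0 * (1 + real (f t)) / (real n + 2))"
  have rad: "0 < rad t" "rad t < r0" if "t \<in> T" for t
  proof -
    have "f t < n" using f(1) that by blast
    then have "1 + real (f t) < real n + 2" by simp
    then show "0 < rad t" "rad t < r0"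
      using r0 by (auto simp: rad_def divide_less_eq)
  qed
  have rad_inj: "s = t" if "s \<in> T" "t \<in> T" "rad s = rad t" for s t
    using that r0 f(2) by (auto simp: rad_def inj_on_def)
  define H where "H = (\<lambda>t. {z. cmod (z $ j - t) \<le> \<rho> \<and> \<psi> z = rad t} \<union> {z. z $ j = t \<and> \<psi> z \<le> rad t})"
  have H_sub: "H t \<subseteq> {z. \<psi> z \<le> r0}" if "t \<in> T" for t
    using rad[OF that] by (auto simp: H_def)
  have H_coord: "cmod (z $ j - t) \<le> \<rho>" if "z \<in> H t" for z t
    using that \<sigma> by (auto simp: H_def \<rho>_def)
  have "closed (H t)" for t
  proof -
    have 1: "closed {z :: complex^'n. cmod (z $ j - t) \<le> \<rho>}" "closed {z :: complex^'n. z $ j = t}"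
      by (intro closed_Collect_le closed_Collect_eq continuous_intros)+
    have "closed ({z. cmod (z $ j - t) \<le> \<rho>} \<inter> {z. \<psi> z = rad t})" "closed ({z. z $ j = t} \<inter> {z. \<psi> z \<le> rad t})"
      by (intro closed_Int 1 closed_le)+
    then show ?thesis unfolding H_def by (simp add: Collect_conj_eq closed_Un)
  qed
  then have H_cpt: "compact (H t)" if "t \<in> T" for t
    using compact_Int_closed[OF cpt, of "H t"] H_sub[OF that] by (simp add: inf.absorb2)
  have H_disj: "H s \<inter> H t = {}" if "s \<in> T" "t \<in> T" "s \<noteq> t" for s t
  proof (rule ccontr)
    assume "H s \<inter> H t \<noteq> {}"
    then obtain z where z: "z \<in> H s" "z \<in> H t" by blast
    \<comment> \<open>Two lateral parts are separated by their levels; any pair involving a slice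
      would require \<open>cmod (s - t) \<le> \<rho>\<close> or equal centres.\<close>
    have far: "\<not> cmod (s - t) \<le> \<rho>" using T(3)[OF that] \<sigma> by (simp add: \<rho>_def)
    have "rad s \<noteq> rad t" using rad_inj that by blast
    then show False
      using z far \<open>s \<noteq> t\<close> by (auto simp: H_def norm_minus_commute)
  qed
  obtain d where d: "d > 0" "\<And>s t x y. s \<in> T \<Longrightarrow> t \<in> T \<Longrightarrow> s \<noteq> t \<Longrightarrow> x \<in> H s \<Longrightarrow> y \<in> H t \<Longrightarrow> d \<le> dist x y"
    using separate_compact_family[OF T(1), of H] H_cpt H_disj by blast
  define X where "X = (\<Union>t\<in>T. H t)"
  \<comment> \<open>With \<open>2 * \<eta> \<le> d\<close> the neighbourhoods of different pieces
    remain disjoint, so a connected set sees only one of them.\<close>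
  define \<eta> where "\<eta> = min (d / 2) \<sigma>"
  have \<eta>: "\<eta> > 0" "2 * \<eta> \<le> d" "\<eta> \<le> \<sigma>" using d(1) \<sigma> by (auto simp: \<eta>_def)
  show thesis
  proof (rule that)
    show "compact X" unfolding X_def using T(1) H_cpt by (intro compact_UN) auto
    show "X \<subseteq> U" using H_sub sub r0(2) unfolding X_def by blast
    show "\<eta> > 0" by fact
    show "captures U X Y"
      unfolding captures_def
    proof (intro allI impI, elim conjE)
      fix A assume A: "closedin (top_of_set U) A" "no_peak_points A" "A \<inter> Y \<noteq> {}"
      then obtain p where p: "p \<in> A" "p \<in> Y" by blast
      have "cmod (p $ j) \<le> R" using R[OF p(2)] Finite_Cartesian_Product.norm_nth_le[of p j] by linarith
      then obtain t where t: "t \<in> T" "cmod (p $ j - t) < \<rho>" using T(2) unfolding \<rho>_def by blast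
      define B where "B = {z. cmod (z $ j - t) \<le> \<rho> \<and> \<psi> z \<le> rad t}"
      have "closed B"
        unfolding B_def Collect_conj_eq
        by (intro closed_Int closed_le closed_Collect_le continuous_intros)
      moreover have B_sub: "B \<subseteq> {z. \<psi> z \<le> r0}" using rad[OF t(1)] by (auto simp: B_def)
      ultimately have "compact B"
        using compact_Int_closed[OF cpt, of B] by (simp add: inf.absorb2)
      moreover have "B \<subseteq> U" using B_sub sub r0(2) by blast
      moreover have "\<psi> p < rad t" using p rad[OF t(1)] by (simp add: \<psi>_def)
      ultimately have "A \<inter> H t \<noteq> {}"
        unfolding H_def using box_capture[OF A(1,2) _ _ B_def \<psi> p(1) t(2)] by blast
      then show "A \<inter> X \<noteq> {}" using t(1) by (auto simp: X_def)
    qed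
    show "thin_components {j} \<epsilon> (\<Union>x\<in>X. ball x \<eta>)"
      unfolding thin_components_def
    proof (intro allI impI ballI, elim conjE)
      fix C x y i assume C: "connected C" "C \<subseteq> (\<Union>x\<in>X. ball x \<eta>)" and xy: "x \<in> C" "y \<in> C" and "i \<in> {j}"
      define N where "N = (\<lambda>t. \<Union>x\<in>H t. ball x \<eta>)"
      have disj: "N s \<inter> N t = {}" if "s \<in> T" "t \<in> T" "s \<noteq> t" for s t
      proof (rule ccontr)
        assume "N s \<inter> N t \<noteq> {}"
        then obtain z a b where z: "a \<in> H s" "b \<in> H t" "dist a z < \<eta>" "dist b z < \<eta>" by (auto simp: N_def)
        have "dist a b < 2 * \<eta>" using z dist_triangle2[of a b z] by linarith
        then show False using d(2)[OF that z(1,2)] \<eta> by linarith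
      qed
      obtain W where W: "W \<in> N ` T" "C \<subseteq> W"
      proof (rule connected_disjoint_Union_open_pick[of "N ` T" "{C}" C])
        show "pairwise disjnt (N ` T)" using disj by (force simp: pairwise_def disjnt_def)
        show "\<Union>{C} \<subseteq> \<Union>(N ` T)" using C by (auto simp: N_def X_def)
      qed (use C xy in \<open>auto simp: N_def\<close>)
      then obtain t where t: "t \<in> T" "C \<subseteq> N t" by auto
      have near: "cmod (z $ j - t) \<le> \<rho> + \<eta>" if zC: "z \<in> C" for z
      proof -
        have "z \<in> N t" using t zC by blast
        then obtain a where a: "a \<in> H t" "dist a z < \<eta>" by (auto simp: N_def)
        have "cmod ((a - z) $ j) \<le> norm (a - z)" by (rule Finite_Cartesian_Product.norm_nth_le)
        then have "cmod (z $ j - a $ j) < \<eta>" using a by (simp add: dist_norm norm_minus_commute)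
        then show ?thesis
          using H_coord[OF a(1)] norm_triangle_ineq[of "z $ j - a $ j" "a $ j - t"] by simp
      qed
      have "cmod (x $ j - y $ j) \<le> cmod (x $ j - t) + cmod (y $ j - t)"
        using norm_triangle_ineq4[of "x $ j - t" "y $ j - t"] by simp
      also have "\<dots> \<le> \<epsilon>" using near[OF xy(1)] near[OF xy(2)] \<eta>(3) \<sigma> by (simp add: \<rho>_def \<sigma>_def)
      finally show "cmod (x $ i - y $ i) \<le> \<epsilon>" using \<open>i \<in> {j}\<close> by simp
    qed
  qed
qed

subsection \<open>The Cantor set\<close>

lemma no_peak_points_Int_open:
  assumes "no_peak_points A" "open U"
  shows "no_peak_points (A \<inter> U)"
  unfolding no_peak_points_def
proof (intro ballI allI impI, elim conjE)
  fix q r G assume q: "q \<in> A \<inter> U" and r: "r > 0" and G: "holomorphic_several G (ball q r)" "G q = 0"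
  obtain e where e: "e > 0" "ball q e \<subseteq> U" using q assms(2) openE by blast
  define s where "s = min e r"
  have s: "s > 0" "ball q s \<subseteq> U" "ball q s \<subseteq> ball q r" using e r by (auto simp: s_def)
  then obtain z where "z \<in> A \<inter> ball q s" "z \<noteq> q" "0 \<le> Re (G z)"
    using assms(1) q G holomorphic_several_subset[OF G(1) s(3)] unfolding no_peak_points_def by blast
  then show "\<exists>z\<in>A \<inter> U \<inter> ball q r. z \<noteq> q \<and> 0 \<le> Re (G z)" using s by blast
qed

lemma closedin_Int_subset:
  assumes "closedin (top_of_set U) A" "U' \<subseteq> U"
  shows "closedin (top_of_set U') (A \<inter> U')"
proof -
  obtain C where "closed C" "A = U \<inter> C" using assms(1) unfolding closedin_closed by blast
  then show ?thesis using assms(2) unfolding closedin_closed by blast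
qed

text \<open>Intersecting a test set with the open set \<open>U'\<close> keeps it relatively closed
  and free of peak points, so the second capture applies to the intersection.\<close>

lemma captures_trans:
  assumes "captures U Y' Y" "captures U' Y'' Y'" "open U'" "U' \<subseteq> U" "Y' \<subseteq> U'"
  shows "captures U Y'' Y"
  unfolding captures_def
proof (intro allI impI, elim conjE)
  fix A assume A: "closedin (top_of_set U) A" "no_peak_points A" "A \<inter> Y \<noteq> {}"
  then have "A \<inter> Y' \<noteq> {}" using assms(1) by (auto simp: captures_def)
  then have "(A \<inter> U') \<inter> Y' \<noteq> {}" using assms(5) by blast
  moreover have "closedin (top_of_set U') (A \<inter> U')" by (rule closedin_Int_subset[OF A(1) assms(4)])
  ultimately have "(A \<inter> U') \<inter> Y'' \<noteq> {}"
    using assms(2) no_peak_points_Int_open[OF A(2) assms(3)] unfolding captures_def by blast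
  then show "A \<inter> Y'' \<noteq> {}" by blast
qed

lemma thin_components_subset:
  "thin_components J \<epsilon> U \<Longrightarrow> U' \<subseteq> U \<Longrightarrow> thin_components J \<epsilon> U'"
  unfolding thin_components_def by blast

lemma thin_components_insert:
  assumes "thin_components {j} \<epsilon> U" "thin_components J \<epsilon> U"
  shows "thin_components (insert j J) \<epsilon> U"
  unfolding thin_components_def
proof (intro allI impI ballI)
  fix C x y i assume "connected C \<and> C \<subseteq> U" "x \<in> C" "y \<in> C" "i \<in> insert j J"
  then show "cmod (x $ i - y $ i) \<le> \<epsilon>"
    using assms unfolding thin_components_def by (cases "i = j") auto
qed

text \<open>The last clause prepares perfectness: each component of \<open>U'\<close> contains a
  ball of \<open>Y'\<close>, in which two disjoint test sets can later be placed. The compact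
  closure prepares the passage to the limit.\<close>

definition refinement :: "'n set \<Rightarrow> real \<Rightarrow> (complex^'n) set \<Rightarrow> (complex^'n) set \<Rightarrow> (complex^'n) set \<Rightarrow> (complex^'n) set \<Rightarrow> bool" where
  "refinement J \<epsilon> U Y U' Y' \<longleftrightarrow> open U' \<and> compact Y' \<and> Y' \<subseteq> U' \<and> compact (closure U') \<and> closure U' \<subseteq> U \<and>
     captures U Y' Y \<and> thin_components J \<epsilon> U' \<and>
     (\<forall>x\<in>U'. connected_component_set U' x \<inter> interior Y' \<noteq> {})"

text \<open>The set from \<open>capture_step\<close> is thickened twice: an open neighbourhood of
  radius \<eta> gives \<open>U'\<close>, and closed balls of half that radius give \<open>Y'\<close>
  interior points in every component.\<close>

lemma refinement_coordinate:
  fixes U Y :: "(complex^'n) set"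
  assumes U: "open U" and Y: "compact Y" "Y \<subseteq> U" and \<epsilon>: "\<epsilon> > 0"
  shows "\<exists>U' Y'. refinement {j} \<epsilon> U Y U' Y'"
proof -
  obtain X \<eta>0 where X: "compact X" "X \<subseteq> U" "\<eta>0 > 0" "captures U X Y" "thin_components {j} \<epsilon> (\<Union>x\<in>X. ball x \<eta>0)"
    by (rule capture_step[OF assms])
  obtain e where e: "e > 0" "(\<Union>x\<in>X. cball x e) \<subseteq> U"
    using compact_subset_open_imp_cball_epsilon_subset[OF X(1) U X(2)] by blast
  define \<eta> where "\<eta> = min \<eta>0 e"
  have \<eta>: "\<eta> > 0" "\<eta> \<le> \<eta>0" "\<eta> \<le> e" using X(3) e(1) by (auto simp: \<eta>_def)
  define U' where "U' = (\<Union>x\<in>X. ball x \<eta>)"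
  define Y' where "Y' = (\<Union>x\<in>X. cball x (\<eta> / 2))"
  have opU: "open U'" by (auto simp: U'_def)
  have cY: "compact Y'" unfolding Y'_def by (rule compact_minkowski_sum_cball[OF X(1)])
  have "cball x (\<eta> / 2) \<subseteq> ball x \<eta>" for x :: "complex^'n" using \<eta>(1) by auto
  then have YU: "Y' \<subseteq> U'" unfolding Y'_def U'_def by blast
  have cl: "closure U' \<subseteq> (\<Union>x\<in>X. cball x \<eta>)"
  proof (rule closure_minimal)
    show "U' \<subseteq> (\<Union>x\<in>X. cball x \<eta>)" unfolding U'_def using ball_subset_cball by blast
    show "closed (\<Union>x\<in>X. cball x \<eta>)"
      by (rule compact_imp_closed[OF compact_minkowski_sum_cball[OF X(1)]])
  qed
  have "(\<Union>x\<in>X. cball x \<eta>) \<subseteq> (\<Union>x\<in>X. cball x e)" using subset_cball[OF \<eta>(3)] by blast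
  then have cl2: "closure U' \<subseteq> U" using cl e(2) by blast
  have cpt: "compact (closure U')"
    using compact_Int_closed[OF compact_minkowski_sum_cball[OF X(1), of \<eta>] closed_closure[of U']] cl
    by (simp add: inf.absorb2)
  have "x \<in> cball x (\<eta> / 2)" for x :: "complex^'n" using \<eta>(1) by simp
  then have "X \<subseteq> Y'" unfolding Y'_def by blast
  then have cap: "captures U Y' Y" using X(4) unfolding captures_def by blast
  have "U' \<subseteq> (\<Union>x\<in>X. ball x \<eta>0)" unfolding U'_def using subset_ball[OF \<eta>(2)] by blast
  then have thin: "thin_components {j} \<epsilon> U'" using thin_components_subset[OF X(5)] by blast
  have "connected_component_set U' x \<inter> interior Y' \<noteq> {}" if xU: "x \<in> U'" for x
  proof -
    obtain y where y: "y \<in> X" "x \<in> ball y \<eta>" using xU unfolding U'_def by blast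
    have "ball y \<eta> \<subseteq> U'" using y(1) by (auto simp: U'_def)
    then have "ball y \<eta> \<subseteq> connected_component_set U' x"
      by (intro connected_component_maximal y(2) connected_ball)
    then have "y \<in> connected_component_set U' x" using \<eta>(1) by (metis centre_in_ball subsetD)
    moreover have "ball y (\<eta> / 2) \<subseteq> Y'" unfolding Y'_def using y(1) ball_subset_cball by blast
    then have "y \<in> interior Y'" using \<eta>(1) by (intro interiorI[of "ball y (\<eta> / 2)"]) auto
    ultimately show ?thesis by blast
  qed
  then show ?thesis
    unfolding refinement_def using opU cY YU cl2 cpt cap thin by blast
qed

text \<open>The coordinates are treated in turn. Thinness in the earlier ones passes to subsets,
  while the clause on components is taken from the last step alone.\<close>

lemma refinement_exists:
  fixes U Y :: "(complex^'n) set"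
  assumes "open U" "compact Y" "Y \<subseteq> U" "\<epsilon> > 0"
  shows "\<exists>U' Y'. refinement UNIV \<epsilon> U Y U' Y'"
proof -
  have "\<exists>U' Y'. refinement J \<epsilon> U Y U' Y'" for J :: "'n set"
    using finite[of J]
  proof (induction J rule: finite_induct)
    case empty
    \<comment> \<open>Any coordinate serves here, as thinness over the empty set of coordinates is
      vacuous.\<close>
    obtain U' Y' where "refinement {undefined} \<epsilon> U Y U' Y'"
      using refinement_coordinate[OF assms] by blast
    then have "refinement {} \<epsilon> U Y U' Y'" by (auto simp: refinement_def thin_components_def)
    then show ?case by blast
  next
    case (insert j J)
    then obtain U' Y' where 1: "refinement J \<epsilon> U Y U' Y'" by blast
    then obtain U'' Y'' where 2: "refinement {j} \<epsilon> U' Y' U'' Y''"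
      using refinement_coordinate[of U' Y' \<epsilon> j] assms(4) unfolding refinement_def by blast
    have U': "open U'" "Y' \<subseteq> U'" "closure U' \<subseteq> U" "captures U Y' Y" "thin_components J \<epsilon> U'"
      using 1 by (simp_all add: refinement_def)
    have U'': "closure U'' \<subseteq> U'" "captures U' Y'' Y'" "thin_components {j} \<epsilon> U''"
      using 2 by (simp_all add: refinement_def)
    have sub: "U'' \<subseteq> U'" "U' \<subseteq> U"
      using U''(1) U'(3) closure_subset by (meson order_trans)+
    have "thin_components (insert j J) \<epsilon> U''"
      by (rule thin_components_insert[OF U''(3) thin_components_subset[OF U'(5) sub(1)]])
    moreover have "captures U Y'' Y" by (rule captures_trans[OF U'(4) U''(2) U'(1) sub(2) U'(2)])
    moreover have "closure U'' \<subseteq> U" using U''(1) sub(2) by (rule order_trans)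
    ultimately have "refinement (insert j J) \<epsilon> U Y U'' Y''"
      using 2 by (simp add: refinement_def)
    then show ?case by blast
  qed
  then show ?thesis .
qed

section \<open>Coordinate lines as test sets\<close>

definition coordinate_line :: "'n \<Rightarrow> complex^'n \<Rightarrow> (complex^'n) set" where
  "coordinate_line k c = {z. \<forall>i. i \<noteq> k \<longrightarrow> z $ i = c $ i}"

lemma closed_coordinate_line: "closed (coordinate_line k c)"
proof -
  have "coordinate_line k c = (\<Inter>i\<in>-{k}. {z. z $ i = c $ i})" by (auto simp: coordinate_line_def)
  then show ?thesis by (auto intro!: closed_Collect_eq continuous_intros)
qed

text \<open>On a complex line a peak would be a strict interior maximum of the modulus of
  \<open>exp G\<close>, against the maximum modulus principle.\<close>

lemma no_peak_points_coordinate_line: "no_peak_points (coordinate_line k c)"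
  unfolding no_peak_points_def
proof (intro ballI allI impI, elim conjE)
  fix q r G assume q: "q \<in> coordinate_line k c" and r: "r > 0" and G: "holomorphic_several G (ball q r)" "G q = 0"
  define b :: "complex^'a" where "b = axis k 1"
  have mem: "q + \<zeta> *s b \<in> coordinate_line k c" for \<zeta>
    using q by (auto simp: coordinate_line_def b_def axis_def)
  have mem_ball: "q + \<zeta> *s b \<in> ball q r \<longleftrightarrow> \<zeta> \<in> ball 0 r" for \<zeta>
    by (simp add: dist_norm norm_smult b_def norm_axis_1)
  show "\<exists>z\<in>coordinate_line k c \<inter> ball q r. z \<noteq> q \<and> 0 \<le> Re (G z)"
  proof (rule ccontr)
    assume neg: "\<not> ?thesis"
    define \<phi> where "\<phi> = (\<lambda>\<zeta>. exp (G (q + \<zeta> *s b)))"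
    have "(\<lambda>\<zeta>. G (q + \<zeta> *s b)) holomorphic_on ball 0 r"
      using holomorphic_several_line[OF G(1), of q b] by (simp only: mem_ball Collect_mem_eq)
    then have hol: "\<phi> holomorphic_on ball 0 r" unfolding \<phi>_def by (intro holomorphic_intros)
    have lt: "cmod (\<phi> \<zeta>) < 1" if "\<zeta> \<in> ball 0 r" "\<zeta> \<noteq> 0" for \<zeta>
    proof -
      have "q + \<zeta> *s b \<noteq> q" using that(2) by (auto simp: b_def vec_eq_iff axis_def)
      then have "Re (G (q + \<zeta> *s b)) < 0"
        using neg mem[of \<zeta>] mem_ball[of \<zeta>] that(1) by (meson IntI not_le)
      then show ?thesis by (simp add: \<phi>_def norm_exp_eq_Re)
    qed
    have \<phi>0: "\<phi> 0 = 1" by (simp add: \<phi>_def G(2))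
    have "\<phi> constant_on ball 0 r"
    proof (rule maximum_modulus_principle[OF hol, where U = "ball 0 r" and \<xi> = 0])
      fix z :: complex assume "z \<in> ball 0 r"
      then show "cmod (\<phi> z) \<le> cmod (\<phi> 0)" using lt[of z] \<phi>0 by (cases "z = 0") auto
    qed (use r in auto)
    then obtain a where "\<And>\<zeta>. \<zeta> \<in> ball 0 r \<Longrightarrow> \<phi> \<zeta> = a" by (auto simp: constant_on_def)
    from this[of "of_real (r/2)"] this[of 0] have "\<phi> (of_real (r/2)) = \<phi> 0" using r by simp
    then show False using lt[of "of_real (r/2)"] r \<phi>0 by simp
  qed
qed

section \<open>The limit of nested refinements\<close>

lemma norm_le_sum_cmod: "norm (x :: complex^'n) \<le> (\<Sum>i\<in>UNIV. cmod (x $ i))"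
  unfolding norm_vec_def by (rule L2_set_le_sum) simp

text \<open>\<open>K\<close> is the intersection of successive refinements with thickness tending to
  0. Thinness makes it totally disconnected, compactness preserves capturing, and two parallel lines
  inside one small component yield two points of \<open>K\<close> there.\<close>

lemma capturing_Cantor_set:
  fixes U Y :: "(complex^'n) set"
  assumes card: "CARD('n) \<ge> 2" and U: "open U" and Y: "compact Y" "Y \<subseteq> U"
  shows "\<exists>K. compact K \<and> K \<subseteq> U \<and> totally_disconnected K \<and> (\<forall>x\<in>K. x islimpt K) \<and> captures U K Y"
proof -
  \<comment> \<open>The clause for \<open>n = 0\<close> fixes the start of the dependent choice at
    \<open>(U, Y)\<close>.\<close>
  define P where "P = (\<lambda>(n::nat) x :: (complex^'n) set \<times> (complex^'n) set.
    open (fst x) \<and> compact (snd x) \<and> snd x \<subseteq> fst x \<and> (n = 0 \<longrightarrow> x = (U, Y)))"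
  have "\<exists>f. \<forall>n. P n (f n) \<and> refinement UNIV (1 / Suc n) (fst (f n)) (snd (f n)) (fst (f (Suc n))) (snd (f (Suc n)))"
  proof (rule dependent_nat_choice)
    show "\<exists>x. P 0 x" using U Y by (auto simp: P_def)
    fix x n assume "P n x"
    then obtain U' Y' where "refinement UNIV (1 / Suc n) (fst x) (snd x) U' Y'"
      using refinement_exists[of "fst x" "snd x" "1 / Suc n"] by (auto simp: P_def)
    then show "\<exists>y. P (Suc n) y \<and> refinement UNIV (1 / Suc n) (fst x) (snd x) (fst y) (snd y)"
      by (intro exI[of _ "(U', Y')"]) (auto simp: P_def refinement_def)
  qed
  then obtain f where f: "\<And>n. P n (f n)"
    "\<And>n. refinement UNIV (1 / Suc n) (fst (f n)) (snd (f n)) (fst (f (Suc n))) (snd (f (Suc n)))" by blast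
  define V W where "V = (\<lambda>n. fst (f n))" and "W = (\<lambda>n. snd (f n))"
  have V0: "V 0 = U" "W 0 = Y" using f(1)[of 0] by (auto simp: P_def V_def W_def)
  have opV: "open (V n)" and WV: "W n \<subseteq> V n" for n using f(1)[of n] by (auto simp: P_def V_def W_def)
  have ref: "refinement UNIV (1 / Suc n) (V n) (W n) (V (Suc n)) (W (Suc n))" for n
    using f(2) by (simp add: V_def W_def)
  have clV: "closure (V (Suc n)) \<subseteq> V n" "compact (closure (V (Suc n)))" "captures (V n) (W (Suc n)) (W n)"
    "thin_components UNIV (1 / Suc n) (V (Suc n))"
    "\<And>x. x \<in> V (Suc n) \<Longrightarrow> connected_component_set (V (Suc n)) x \<inter> interior (W (Suc n)) \<noteq> {}" for n
    using ref[of n] by (auto simp: refinement_def)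
  have "V (Suc n) \<subseteq> V n" for n using clV(1)[of n] closure_subset by blast
  then have dec: "V n \<subseteq> V m" if "m \<le> n" for m n
    using that by (rule lift_Suc_antimono_le)
  define K where "K = (\<Inter>n. V n)"
  have K_eq: "K = (\<Inter>n. closure (V (Suc n)))"
  proof
    show "K \<subseteq> (\<Inter>n. closure (V (Suc n)))" using closure_subset unfolding K_def by blast
    show "(\<Inter>n. closure (V (Suc n))) \<subseteq> K" using clV(1) unfolding K_def by blast
  qed
  have "closed K" unfolding K_eq by auto
  have "K \<subseteq> closure (V (Suc 0))" using K_eq by blast
  then have "compact K"
    using compact_Int_closed[OF clV(2)[of 0] \<open>closed K\<close>] by (simp add: inf.absorb2)
  have cap_chain: "captures (V n) (W (n + m)) (W n)" for n m
  proof (induction m)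
    case 0
    show ?case by (simp add: captures_def)
  next
    case (Suc m)
    then show ?case
      using captures_trans[OF Suc clV(3)[of "n + m"] opV dec[of n "n + m"] WV] by simp
  qed
  have cap: "captures (V n) K (W n)" for n
    unfolding captures_def
  proof (intro allI impI, elim conjE)
    fix A assume A: "closedin (top_of_set (V n)) A" "no_peak_points A" "A \<inter> W n \<noteq> {}"
    obtain C where C: "closed C" "A = V n \<inter> C" using A(1) unfolding closedin_closed by blast
    \<comment> \<open>Nested nonempty compact sets; a common point lies in \<open>C\<close> and in
      every \<open>V m\<close>, hence in \<open>A\<close> and in \<open>K\<close>.\<close>
    define F where "F = (\<lambda>m. C \<inter> closure (V (Suc (n + m))))"
    have "A \<inter> W (n + Suc m) \<noteq> {}" for m
      using cap_chain[of n "Suc m"] A unfolding captures_def by blast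
    then have "F m \<noteq> {}" for m
      using WV[of "n + Suc m"] C(2) closure_subset[of "V (Suc (n + m))"] unfolding F_def by fastforce
    moreover have "compact (F m)" for m
      unfolding F_def Int_commute[of C] by (rule compact_Int_closed[OF clV(2) C(1)])
    moreover have "F m' \<subseteq> F m" if "m \<le> m'" for m m'
      using dec[of "Suc (n + m)" "Suc (n + m')"] closure_mono that unfolding F_def by (simp add: closure_mono inf.coboundedI2)
    ultimately have "\<Inter>(range F) \<noteq> {}"
      by (intro compact_nest) auto
    then obtain x where x: "\<And>m. x \<in> F m" by auto
    have "x \<in> V m" for m
    proof -
      have "x \<in> V (n + m)" using x[of m] clV(1)[of "n + m"] unfolding F_def by blast
      then show ?thesis using dec[of m "n + m"] by auto
    qed
    then have "x \<in> A \<inter> K" using x[of 0] C(2) by (auto simp: K_def F_def)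
    then show "A \<inter> K \<noteq> {}" by blast
  qed
  have "totally_disconnected K"
    unfolding totally_disconnected_def
  proof (intro allI impI, elim conjE)
    fix C assume C: "C \<subseteq> K" "connected C"
    have "x = y" if "x \<in> C" "y \<in> C" for x y
    proof -
      have "cmod (x $ j - y $ j) \<le> 1 / Suc n" for j n
        using clV(4)[of n] C that unfolding thin_components_def K_def by blast
      then have "cmod (x $ j - y $ j) \<le> 0" for j
        by (metis nat_approx_posE not_le)
      then show ?thesis by (simp add: vec_eq_iff)
    qed
    then show "\<exists>x. C \<subseteq> {x}" by blast
  qed
  moreover have "x islimpt K" if x: "x \<in> K" for x
    unfolding islimpt_approachable
  proof (intro allI impI)
    fix e :: real assume "e > 0"
    \<comment> \<open>Thinness bounds each coordinate separately, and the norm is at most the sum of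
      \<open>CARD('n)\<close> coordinate moduli.\<close>
    then have "e / CARD('n) > 0" by simp
    then obtain n where n: "1 / Suc n < e / CARD('n)" by (rule nat_approx_posE)
    define D where "D = connected_component_set (V (Suc n)) x"
    have xV: "x \<in> V (Suc n)" using x by (auto simp: K_def)
    have opD: "open D" unfolding D_def by (rule open_connected_component[OF opV])
    have close: "dist w x < e" if "w \<in> D" for w
    proof -
      have "x \<in> D" using xV by (simp add: D_def)
      moreover have "connected D" "D \<subseteq> V (Suc n)" by (auto simp: D_def connected_component_subset)
      ultimately have "cmod (w $ j - x $ j) \<le> 1 / Suc n" for j
        using clV(4)[of n] that unfolding thin_components_def by blast
      then have "(\<Sum>j\<in>UNIV. cmod ((w - x) $ j)) \<le> of_nat CARD('n) * (1 / Suc n)"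
        by (intro sum_bounded_above) simp
      also have "\<dots> < e" using n by (simp add: field_simps)
      finally show ?thesis using norm_le_sum_cmod[of "w - x"] by (simp add: dist_norm)
    qed
    have "open (D \<inter> interior (W (Suc n)))" using opD by auto
    moreover obtain y where y: "y \<in> D \<inter> interior (W (Suc n))" using clV(5)[OF xV] by (auto simp: D_def)
    ultimately obtain s where s: "s > 0" "ball y s \<subseteq> D \<inter> interior (W (Suc n))" by (rule openE)
    \<comment> \<open>The lines run in direction \<open>k\<close>; a second direction
      \<open>l\<close> is needed to shift one of them off the other, and this is where the dimension
      enters.\<close>
    obtain k l :: 'n where kl: "k \<noteq> l"
      using card by (metis card_2_iff' card_le_Suc0_iff_eq finite_class.finite_UNIV iso_tuple_UNIV_I not_less_eq_eq numeral_2_eq_2)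
    have hit: "coordinate_line k c \<inter> D \<inter> K \<noteq> {}" if "c \<in> ball y s" for c
    proof -
      \<comment> \<open>The component \<open>D\<close> is open and also relatively closed in
        \<open>V (Suc n)\<close>, so the part of the line in \<open>D\<close> is an admissible test
        set, and the captured point stays near \<open>x\<close>.\<close>
      have "closedin (top_of_set (V (Suc n))) (V (Suc n) \<inter> coordinate_line k c)"
        by (rule closedin_closed_Int[OF closed_coordinate_line])
      moreover have "closedin (top_of_set (V (Suc n))) D"
        unfolding D_def by (rule closedin_connected_component)
      ultimately have "closedin (top_of_set (V (Suc n))) (V (Suc n) \<inter> coordinate_line k c \<inter> D)"
        by (rule closedin_Int)
      moreover have "V (Suc n) \<inter> coordinate_line k c \<inter> D = coordinate_line k c \<inter> D"
        using connected_component_subset[of "V (Suc n)" x] by (auto simp: D_def)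
      ultimately have "closedin (top_of_set (V (Suc n))) (coordinate_line k c \<inter> D)" by simp
      moreover have "no_peak_points (coordinate_line k c \<inter> D)"
        by (rule no_peak_points_Int_open[OF no_peak_points_coordinate_line opD])
      moreover have "c \<in> coordinate_line k c \<inter> D \<inter> W (Suc n)"
        using subsetD[OF s(2) that] interior_subset[of "W (Suc n)"] by (auto simp: coordinate_line_def)
      ultimately show ?thesis using cap[of "Suc n"] unfolding captures_def by blast
    qed
    \<comment> \<open>A shift by \<open>s/2\<close> in direction \<open>l\<close> stays in the ball
      around \<open>y\<close> and gives a disjoint parallel line, so at least one of the two
      captured points differs from \<open>x\<close>.\<close>
    define c where "c = y + of_real (s / 2) *s axis l (1::complex)"
    have "c \<in> ball y s" using s(1) by (simp add: c_def dist_norm norm_smult norm_axis_1)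
    then obtain w1 w2 where w: "w1 \<in> coordinate_line k y" "w1 \<in> D" "w1 \<in> K"
        "w2 \<in> coordinate_line k c" "w2 \<in> D" "w2 \<in> K"
      using hit[of y] hit[of c] s(1) by auto
    have "w1 $ l = y $ l" "w2 $ l = y $ l + of_real (s / 2)"
      using w kl by (auto simp: coordinate_line_def c_def axis_def)
    then have "w1 \<noteq> w2" using s(1) by auto
    then have "w1 \<noteq> x \<or> w2 \<noteq> x" by auto
    then show "\<exists>x'\<in>K. x' \<noteq> x \<and> dist x' x < e" using w close by blast
  qed
  moreover have "K \<subseteq> U" using V0 by (auto simp: K_def)
  moreover have "captures U K Y" using cap[of 0] V0 by simp
  ultimately show ?thesis using \<open>compact K\<close> by blast
qed

section \<open>Union over concentric spheres\<close>

lemma no_peak_points_meets_sphere: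
  fixes A :: "(complex^'n) set"
  assumes A: "closed A" "no_peak_points A" "p \<in> A" and r: "norm p < r"
  shows "A \<inter> sphere 0 r \<noteq> {}"
proof
  assume empty: "A \<inter> sphere 0 r = {}"
  have "compact (A \<inter> cball 0 r)" by (rule closed_Int_compact[OF A(1) compact_cball])
  moreover have "A \<inter> cball 0 r \<noteq> {}" using A r by force
  moreover have "continuous_on (A \<inter> cball 0 r) norm" by (intro continuous_intros)
  ultimately obtain q where q0: "q \<in> A \<inter> cball 0 r" "\<forall>z\<in>A \<inter> cball 0 r. norm z \<le> norm q"
    using continuous_attains_sup[of "A \<inter> cball 0 r" norm] by blast
  then have q: "q \<in> A" "norm q \<le> r" "\<And>z. z \<in> A \<Longrightarrow> norm z \<le> r \<Longrightarrow> norm z \<le> norm q"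
    by simp_all
  have "norm q \<noteq> r" using empty q by auto
  then have e: "r - norm q > 0" using q by simp
  \<comment> \<open>A maximum of the norm on \<open>A\<close> inside the ball contradicts the
    maximum principle with holomorphic part 0 and coefficient 1.\<close>
  show False
  proof (rule no_peak_points_strict_max[OF A(2) q(1) e, of 1 "\<lambda>_. 0"])
    show "holomorphic_several (\<lambda>_. 0) (ball q (r - norm q))" by (rule holomorphic_several_const)
    fix z assume z: "z \<in> A" "z \<in> ball q (r - norm q)"
    then have "norm z \<le> r" using norm_triangle_ineq2[of z q] by (simp add: dist_norm norm_minus_commute)
    then have "norm z \<le> norm q" using q(3) z by blast
    then show "Re 0 + 1 * (norm z)\<^sup>2 \<le> Re 0 + 1 * (norm q)\<^sup>2" by simp
  qed simp
qed

theorem theorem6p2: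
  assumes "CARD('n::finite) \<ge> 2"
  shows "\<exists>S :: (complex^'n) set. totally_disconnected S \<and> perfect_set S \<and>
           (\<forall>V. analytic_subvariety V \<and> positive_dimensional V \<longrightarrow> S \<inter> V \<noteq> {})"
proof -
  \<comment> \<open>Shells around the spheres of radius \<open>k + 1\<close>; they are disjoint
    because \<open>4/3 < 1 + 2/3\<close>.\<close>
  define U where "U = (\<lambda>k::nat. {z::complex^'n. real k + 2/3 < norm z \<and> norm z < real k + 4/3})"
  have opU: "open (U k)" for k
    unfolding U_def Collect_conj_eq by (intro open_Int open_Collect_less continuous_intros)
  have "\<exists>K. compact K \<and> K \<subseteq> U k \<and> totally_disconnected K \<and> (\<forall>x\<in>K. x islimpt K) \<and>
      captures (U k) K (sphere 0 (real k + 1))" for k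
    by (rule capturing_Cantor_set[OF assms opU compact_sphere]) (auto simp: U_def)
  then obtain K where K: "\<And>k. compact (K k)" "\<And>k. K k \<subseteq> U k" "\<And>k. totally_disconnected (K k)"
    "\<And>k x. x \<in> K k \<Longrightarrow> x islimpt K k" "\<And>k. captures (U k) (K k) (sphere 0 (real k + 1))"
    by metis
  have disj: "U k \<inter> U m = {}" if "k \<noteq> m" for k m
    using that by (auto simp: U_def)
  define S where "S = (\<Union>k. K k)"
  have "totally_disconnected S"
    unfolding totally_disconnected_def
  proof (intro allI impI, elim conjE)
    fix C assume C: "C \<subseteq> S" "connected C"
    show "\<exists>x. C \<subseteq> {x}"
    proof (cases "C = {}")
      case False
      \<comment> \<open>The shells are disjoint and open, so a connected subset of \<open>S\<close>
        lies in one shell and hence in one \<open>K k\<close>.\<close>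
      obtain W where "W \<in> range U" "C \<subseteq> W"
      proof (rule connected_disjoint_Union_open_pick[of "range U" "{C}" C])
        show "pairwise disjnt (range U)" by (rule pairwise_imageI) (simp add: disj disjnt_def)
        show "\<Union>{C} \<subseteq> \<Union>(range U)" using C(1) K(2) unfolding S_def by blast
      qed (use C False opU in auto)
      then obtain k where k: "C \<subseteq> U k" by auto
      have "C \<subseteq> K k"
      proof
        fix x assume x: "x \<in> C"
        then obtain m where m: "x \<in> K m" using C(1) by (auto simp: S_def)
        then have "m = k" using disj[of m k] K(2)[of m] k x by blast
        then show "x \<in> K k" using m by simp
      qed
      then show ?thesis using K(3)[of k] C(2) unfolding totally_disconnected_def by blast
    qed auto
  qed
  moreover have "perfect_set S"
    unfolding perfect_set_def
  proof
    \<comment> \<open>Closedness of the infinite union: a ball of radius 1 meets only the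
      \<open>K k\<close> with \<open>k\<close> below a bound depending on its centre.\<close>
    have "locally_finite_in euclidean (range K)"
      unfolding locally_finite_in_def
    proof (intro conjI ballI)
      fix x :: "complex^'n"
      have "{B \<in> range K. B \<inter> ball x 1 \<noteq> {}} \<subseteq> K ` {..nat \<lceil>norm x + 1\<rceil>}"
      proof
        fix B assume "B \<in> {B \<in> range K. B \<inter> ball x 1 \<noteq> {}}"
        then obtain k z where k: "B = K k" "z \<in> K k" "z \<in> ball x 1" by blast
        have "z \<in> U k" using k(2) K(2) by blast
        then have "real k < norm z" by (simp add: U_def)
        also have "norm z < norm x + 1" using k(3) norm_triangle_ineq2[of z x] by (simp add: dist_norm norm_minus_commute)
        finally have "k \<le> nat \<lceil>norm x + 1\<rceil>" by linarith
        then show "B \<in> K ` {..nat \<lceil>norm x + 1\<rceil>}" using k by blast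
      qed
      then have "finite {B \<in> range K. B \<inter> ball x 1 \<noteq> {}}" by (rule finite_subset) simp
      then show "\<exists>V. openin euclidean V \<and> x \<in> V \<and> finite {B \<in> range K. B \<inter> V \<noteq> {}}"
        by (intro exI[of _ "ball x 1"]) auto
    qed auto
    then have "closedin euclidean (\<Union>(range K))"
      by (rule closedin_locally_finite_Union[rotated]) (use K(1) compact_imp_closed in auto)
    then show "closed S" by (simp add: S_def)
    show "\<forall>x\<in>S. x islimpt S"
    proof
      fix x assume "x \<in> S"
      then obtain k where "x \<in> K k" by (auto simp: S_def)
      then show "x islimpt S" by (rule islimpt_subset[OF K(4)]) (auto simp: S_def)
    qed
  qed
  moreover have "S \<inter> V \<noteq> {}" if V: "analytic_subvariety V" "positive_dimensional V" for V
  proof -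
    obtain p where p: "p islimpt V" using V(2) by (auto simp: positive_dimensional_def)
    define A where "A = condensation_points V"
    have A: "closed A" "no_peak_points A" "p \<in> A" "A \<subseteq> V"
      using closed_condensation_points no_peak_points_condensation_points[OF V(1)]
        limpt_imp_condensation_point[OF V(1) p] condensation_points_subset V(1)
      by (auto simp: A_def analytic_subvariety_def)
    \<comment> \<open>The sphere has to enclose the point \<open>p\<close> of \<open>A\<close>, so
      that \<open>A\<close> must meet it.\<close>
    obtain k where "norm p < real k" using reals_Archimedean2 by blast
    then have "A \<inter> sphere 0 (real k + 1) \<noteq> {}"
      by (intro no_peak_points_meets_sphere[OF A(1-3)]) simp
    moreover have "sphere 0 (real k + 1) \<subseteq> U k" by (auto simp: U_def)
    ultimately have "(A \<inter> U k) \<inter> sphere 0 (real k + 1) \<noteq> {}" by blast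
    moreover have "closedin (top_of_set (U k)) (A \<inter> U k)"
      using closedin_closed_Int[OF A(1), of "U k"] by (simp add: Int_commute)
    ultimately have "(A \<inter> U k) \<inter> K k \<noteq> {}"
      using K(5)[of k] no_peak_points_Int_open[OF A(2) opU] unfolding captures_def by blast
    then show ?thesis using A(4) by (auto simp: S_def)
  qed
  ultimately show ?thesis by blast
qed

end
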